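(* There exists an algorithm that takes as input a hypergraph $H$ and a family $\mathbf{S}\subseteq 2^{V(H)}$ and decides in polynomial time whether there exists a candidate tree decomposition of $\mathbf{S}$ (for $H$) that is in component normal form, and, if so, returns such a tree decomposition.
   Context: A hypergraph $H=(V(H),E(H))$ consists of a finite set $V(H)$ of vertices and a set $E(H)$ of non-empty subsets of $V(H)$ (edges), such that every vertex lies in at least one edge. A tree decomposition (TD) of $H$ is a pair $\langle T,(B_u)_{u\in T}\rangle$ with $T$ a rooted tree and bags $B_u\subseteq V(H)$ such that (1) each $e\in E(H)$ satisfies $e\subseteq B_u$ for some node $u$, and (2) for each $v\in V(H)$ the set $\{u\in T: v\in B_u\}$ is connected in $T$. Given $\mathbf{S}\subseteq 2^{V(H)}$ (given explicitly in the input), a TD of $H$ is a candidate tree decomposition of $\mathbf{S}$ if $B_u\in\mathbf{S}$ for every node $u$. For $C\subseteq V(H)$, a $[C]$-path from $v$ to $v'$ is a sequence of vertices $v=v_0,\dots,v_h=v'$ and edges $e_0,\dots,e_{h-1}$ ($h\ge 0$) with $\{v_j,v_{j+1}\}\subseteq e_j\setminus C$ for all $j$. A set $W$ of vertices is $[C]$-connected if any two of its vertices are joined by a $[C]$-path; a $[C]$-component is a maximal $[C]$-connected non-empty set $W\subseteq V(H)\setminus C$. For a node $s$ of $T$, $T_s$ denotes the subtree rooted at $s$ and $V(T_s)=\bigcup_{u\in T_s}B_u$. A TD is in component normal form if for each node $r$ of $T$ and each child $s$ of $r$ there is exactly one $[B_r]$-component $C_s$ such that $V(T_s)=C_s\cup(B_r\cap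 B_s)$. *)

theory Defs
  imports Main "HOL-Computational_Algebra.Polynomial"
begin

section \<open>Hypergraphs and components\<close>

record 'a hypergraph =
  verts :: "'a set"
  edges :: "'a set set"

definition hypergraph :: "'a hypergraph \<Rightarrow> bool" where
  "hypergraph H \<longleftrightarrow>
     finite (verts H) \<and>
     (\<forall>e\<in>edges H. e \<noteq> {} \<and> e \<subseteq> verts H) \<and>
     (\<forall>v\<in>verts H. \<exists>e\<in>edges H. v \<in> e)"

definition path_joined :: "'a hypergraph \<Rightarrow> 'a set \<Rightarrow> 'a \<Rightarrow> 'a \<Rightarrow> bool" where
  "path_joined H C v v' \<longleftrightarrow>
     (\<exists>(h::nat) x e. x 0 = v \<and> x h = v' \<and>
        (\<forall>j\<le>h. x j \<in> verts H) \<and>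
        (\<forall>j<h. e j \<in> edges H \<and> {x j, x (Suc j)} \<subseteq> e j - C))"

definition C_connected :: "'a hypergraph \<Rightarrow> 'a set \<Rightarrow> 'a set \<Rightarrow> bool" where
  "C_connected H C W \<longleftrightarrow>
     W \<subseteq> verts H \<and> (\<forall>v\<in>W. \<forall>v'\<in>W. path_joined H C v v')"

definition component :: "'a hypergraph \<Rightarrow> 'a set \<Rightarrow> 'a set \<Rightarrow> bool" where
  "component H C W \<longleftrightarrow>
     W \<noteq> {} \<and> W \<subseteq> verts H - C \<and> C_connected H C W \<and>
     (\<forall>W'. W \<subseteq> W' \<and> W' \<subseteq> verts H - C \<and> C_connected H C W' \<longrightarrow> W' = W)"


section \<open>Rooted trees and tree decompositions\<close>

text \<open>A finite rooted tree with labelled nodes. A node is identified with the list of child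
  indices that leads to it from the root: the root is \<open>[]\<close>, and the children of \<open>p\<close> are the
  nodes \<open>p @ [i]\<close>. Distinct nodes may carry equal labels.\<close>

datatype 'b rtree = Node (label: 'b) (children: "'b rtree list")

primrec is_node :: "'b rtree \<Rightarrow> nat list \<Rightarrow> bool" where
  "is_node T [] \<longleftrightarrow> True"
| "is_node T (i # p) \<longleftrightarrow> i < length (children T) \<and> is_node (children T ! i) p"

definition nodes :: "'b rtree \<Rightarrow> nat list set" where
  "nodes T = {p. is_node T p}"

text \<open>Meaningful only at nodes of the tree.\<close>

primrec subtree :: "'b rtree \<Rightarrow> nat list \<Rightarrow> 'b rtree" where
  "subtree T [] = T"
| "subtree T (i # p) = subtree (children T ! i) p"

definition child_of :: "nat list \<Rightarrow> nat list \<Rightarrow> bool" where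
  "child_of s r \<longleftrightarrow> (\<exists>i. s = r @ [i])"

definition connected_nodes :: "nat list set \<Rightarrow> bool" where
  "connected_nodes N \<longleftrightarrow>
     (\<forall>p\<in>N. \<forall>q\<in>N.
        (p, q) \<in> {(a, b). a \<in> N \<and> b \<in> N \<and> (child_of a b \<or> child_of b a)}\<^sup>*)"

text \<open>A decomposition is a rooted tree in which each node is labelled with its bag.\<close>

definition bag :: "'a set rtree \<Rightarrow> nat list \<Rightarrow> 'a set" where
  "bag T u = label (subtree T u)"

definition tree_verts :: "'a set rtree \<Rightarrow> 'a set" where
  "tree_verts T = (\<Union>u\<in>nodes T. bag T u)"

definition tree_decomposition :: "'a hypergraph \<Rightarrow> 'a set rtree \<Rightarrow> bool" where
  "tree_decomposition H T \<longleftrightarrow>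
     (\<forall>u\<in>nodes T. bag T u \<subseteq> verts H) \<and>
     (\<forall>e\<in>edges H. \<exists>u\<in>nodes T. e \<subseteq> bag T u) \<and>
     (\<forall>v\<in>verts H. connected_nodes {u \<in> nodes T. v \<in> bag T u})"

definition candidate_td :: "'a hypergraph \<Rightarrow> 'a set set \<Rightarrow> 'a set rtree \<Rightarrow> bool" where
  "candidate_td H S T \<longleftrightarrow> tree_decomposition H T \<and> (\<forall>u\<in>nodes T. bag T u \<in> S)"

definition component_normal_form :: "'a hypergraph \<Rightarrow> 'a set rtree \<Rightarrow> bool" where
  "component_normal_form H T \<longleftrightarrow>
     (\<forall>r\<in>nodes T. \<forall>s\<in>nodes T. child_of s r \<longrightarrow>
        (\<exists>!C. component H (bag T r) C \<and>
              tree_verts (subtree T s) = C \<union> (bag T r \<inter> bag T s)))"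


section \<open>Algorithms and running time\<close>

text \<open>The machine model is the WHILE language over binary trees (N. D. Jones, Computability and
  Complexity, 1997). Every evaluated subexpression is charged the size of the values it handles
  (instead of unit cost), so that trees of superpolynomial size cannot be built in polynomial time.
  With this charging, time is polynomially related to Turing machine time.\<close>

datatype tree = Leaf | Branch tree tree

primrec tsize :: "tree \<Rightarrow> nat" where
  "tsize Leaf = 1"
| "tsize (Branch l r) = Suc (tsize l + tsize r)"

primrec hd_tree :: "tree \<Rightarrow> tree" where
  "hd_tree Leaf = Leaf"
| "hd_tree (Branch l r) = l"

primrec tl_tree :: "tree \<Rightarrow> tree" where
  "tl_tree Leaf = Leaf"
| "tl_tree (Branch l r) = r"

text \<open>As a truth value, \<open>Leaf\<close> is false and every other tree is true.\<close>

definition tree_of_bool :: "bool \<Rightarrow> tree" where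
  "tree_of_bool b = (if b then Branch Leaf Leaf else Leaf)"

type_synonym store = "nat \<Rightarrow> tree"

datatype exp =
    Var nat
  | ELeaf
  | EBranch exp exp
  | EHd exp
  | ETl exp
  | EEqual exp exp

primrec eval :: "exp \<Rightarrow> store \<Rightarrow> tree" where
  "eval (Var x) s = s x"
| "eval ELeaf s = Leaf"
| "eval (EBranch a b) s = Branch (eval a s) (eval b s)"
| "eval (EHd a) s = hd_tree (eval a s)"
| "eval (ETl a) s = tl_tree (eval a s)"
| "eval (EEqual a b) s = tree_of_bool (eval a s = eval b s)"

text \<open>The cost of reading the operands of an operation is contained in the cost of the
  subexpressions.\<close>

primrec eval_cost :: "exp \<Rightarrow> store \<Rightarrow> nat" where
  "eval_cost (Var x) s = tsize (s x)"
| "eval_cost ELeaf s = 1"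
| "eval_cost (EBranch a b) s = eval_cost a s + eval_cost b s + tsize (eval (EBranch a b) s)"
| "eval_cost (EHd a) s = eval_cost a s + tsize (eval (EHd a) s)"
| "eval_cost (ETl a) s = eval_cost a s + tsize (eval (ETl a) s)"
| "eval_cost (EEqual a b) s = eval_cost a s + eval_cost b s + tsize (eval (EEqual a b) s)"

datatype com =
    Skip
  | Assign nat exp
  | Seq com com
  | Cond exp com com
  | While exp com

text \<open>\<open>exec c s t s'\<close>: started in store \<open>s\<close>, the program \<open>c\<close> halts after time \<open>t\<close> in store \<open>s'\<close>.\<close>

inductive exec :: "com \<Rightarrow> store \<Rightarrow> nat \<Rightarrow> store \<Rightarrow> bool" where
  exec_Skip: "exec Skip s 1 s"
| exec_Assign: "exec (Assign x a) s (Suc (eval_cost a s)) (s(x := eval a s))"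
| exec_Seq: "exec c1 s1 t1 s2 \<Longrightarrow> exec c2 s2 t2 s3 \<Longrightarrow> exec (Seq c1 c2) s1 (Suc (t1 + t2)) s3"
| exec_CondT: "eval a s \<noteq> Leaf \<Longrightarrow> exec c1 s t s' \<Longrightarrow>
    exec (Cond a c1 c2) s (Suc (eval_cost a s + t)) s'"
| exec_CondF: "eval a s = Leaf \<Longrightarrow> exec c2 s t s' \<Longrightarrow>
    exec (Cond a c1 c2) s (Suc (eval_cost a s + t)) s'"
| exec_WhileF: "eval a s = Leaf \<Longrightarrow> exec (While a c) s (Suc (eval_cost a s)) s"
| exec_WhileT: "eval a s1 \<noteq> Leaf \<Longrightarrow> exec c s1 t1 s2 \<Longrightarrow> exec (While a c) s2 t2 s3 \<Longrightarrow>
    exec (While a c) s1 (Suc (eval_cost a s1 + t1 + t2)) s3"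

text \<open>Input and output are passed in variable 0; all other variables are initially \<open>Leaf\<close>.\<close>

definition computes_in :: "com \<Rightarrow> tree \<Rightarrow> nat \<Rightarrow> tree \<Rightarrow> bool" where
  "computes_in c inp t out \<longleftrightarrow> (\<exists>s. exec c ((\<lambda>_. Leaf)(0 := inp)) t s \<and> out = s 0)"

lemma exec_deterministic: "exec c s t s' \<Longrightarrow> exec c s u s'' \<Longrightarrow> t = u \<and> s' = s''"
proof (induction arbitrary: u s'' rule: exec.induct)
  case (exec_Skip s) then show ?case by (auto elim: exec.cases)
next
  case (exec_Assign x a s) then show ?case by (auto elim: exec.cases)
next
  case (exec_Seq c1 s1 t1 s2 c2 t2 s3)
  from exec_Seq.prems show ?case
    by (cases rule: exec.cases) (use exec_Seq.IH in blast)+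
next
  case (exec_CondT a s c1 t s' c2)
  from exec_CondT.prems show ?case
    by (cases rule: exec.cases) (use exec_CondT in blast)+
next
  case (exec_CondF a s c2 t s' c1)
  from exec_CondF.prems show ?case
    by (cases rule: exec.cases) (use exec_CondF in blast)+
next
  case (exec_WhileF a s c)
  from exec_WhileF.prems show ?case
    by (cases rule: exec.cases) (use exec_WhileF in blast)+
next
  case (exec_WhileT a s1 c t1 s2 t2 s3)
  from exec_WhileT.prems show ?case
    by (cases rule: exec.cases) (use exec_WhileT in blast)+
qed


section \<open>Encodings\<close>

text \<open>Binary, least significant bit first, no leading zeros.\<close>

fun enc_nat :: "nat \<Rightarrow> tree" where
  "enc_nat n = (if n = 0 then Leaf else Branch (tree_of_bool (odd n)) (enc_nat (n div 2)))"

declare enc_nat.simps [simp del]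

primrec enc_list :: "('b \<Rightarrow> tree) \<Rightarrow> 'b list \<Rightarrow> tree" where
  "enc_list f [] = Leaf"
| "enc_list f (x # xs) = Branch (f x) (enc_list f xs)"

primrec enc_rtree :: "('b \<Rightarrow> tree) \<Rightarrow> 'b rtree \<Rightarrow> tree" where
  "enc_rtree f (Node b ts) = Branch (f b) (enc_list id (map (enc_rtree f) ts))"

primrec enc_option :: "('b \<Rightarrow> tree) \<Rightarrow> 'b option \<Rightarrow> tree" where
  "enc_option f None = Leaf"
| "enc_option f (Some x) = Branch Leaf (f x)"

text \<open>Finite sets are given as lists, in any order and possibly with repetitions. Vertices are
  natural numbers.\<close>

definition enc_input :: "nat list \<Rightarrow> nat list list \<Rightarrow> nat list list \<Rightarrow> tree" where
  "enc_input vs es ss =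
     Branch (enc_list enc_nat vs)
       (Branch (enc_list (enc_list enc_nat) es) (enc_list (enc_list enc_nat) ss))"

definition enc_output :: "nat list rtree option \<Rightarrow> tree" where
  "enc_output = enc_option (enc_rtree (enc_list enc_nat))"

lemma enc_nat_inj: "enc_nat m = enc_nat n \<Longrightarrow> m = n"
proof (induction m arbitrary: n rule: less_induct)
  case (less m)
  show ?case
  proof (cases "m = 0 \<or> n = 0")
    case True
    then show ?thesis using less.prems
      by (subst (asm) (1 2) enc_nat.simps) (auto split: if_splits)
  next
    case False
    then have "tree_of_bool (odd m) = tree_of_bool (odd n)" "enc_nat (m div 2) = enc_nat (n div 2)"
      using less.prems by (subst (asm) (1 2) enc_nat.simps; simp)+
    then have "odd m = odd n" "m div 2 = n div 2"
      using less.IH[of "m div 2" "n div 2"] False by (auto simp: tree_of_bool_def split: if_splits)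
    then show ?thesis by (metis even_two_times_div_two odd_two_times_div_two_succ)
  qed
qed

lemma enc_list_inj:
  "(\<And>x y. x \<in> set xs \<Longrightarrow> f x = f y \<Longrightarrow> x = y) \<Longrightarrow> enc_list f xs = enc_list f ys \<Longrightarrow> xs = ys"
proof (induction xs arbitrary: ys)
  case Nil then show ?case by (cases ys) auto
next
  case (Cons x xs) then show ?case by (cases ys) auto
qed

lemma enc_list_map: "enc_list f (map g xs) = enc_list (\<lambda>x. f (g x)) xs"
  by (induction xs) auto

lemma enc_rtree_inj:
  assumes "\<And>x y. f x = f y \<Longrightarrow> x = y"
  shows "enc_rtree f T = enc_rtree f T' \<Longrightarrow> T = T'"
proof (induction T arbitrary: T')
  case (Node b ts)
  obtain b' ts' where T': "T' = Node b' ts'" by (cases T')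
  have "enc_list (enc_rtree f) ts = enc_list (enc_rtree f) ts'"
    using Node.prems by (simp add: T' enc_list_map)
  then have "ts = ts'" using Node.IH enc_list_inj by metis
  then show ?case using Node.prems assms by (simp add: T')
qed

lemma enc_output_inj: "enc_output x = enc_output y \<Longrightarrow> x = y"
  unfolding enc_output_def
  by (cases x; cases y) (auto dest!: enc_rtree_inj[rotated] intro: enc_list_inj enc_nat_inj)

end

theory Submission
  imports Defs
begin

text \<open>A subproblem is a pair \<open>(X, C)\<close> of a set \<open>X \<in> S\<close> and an \<open>[X]\<close>-component \<open>C\<close>: find the
  subtree that hangs below a node with bag \<open>X\<close> and covers \<open>C\<close>. Whether \<open>Y \<in> S\<close> can be the root bag
  of this subtree is a local condition on \<open>X\<close>, \<open>C\<close> and \<open>Y\<close>, and what remains are the subproblems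
  \<open>(Y, D)\<close> for the \<open>[Y]\<close>-components \<open>D\<close> that meet \<open>C\<close>, all of which are then contained in \<open>C\<close>. One
  may insist that \<open>Y\<close> meets \<open>C\<close>. Then the components strictly shrink, so that \<open>|V|\<close> rounds of tabulation
  suffice, and a solution of \<open>(X, C)\<close> has at most \<open>|C|\<close> nodes, which keeps all tables polynomial. The
  whole problem is the subproblem with empty \<open>X\<close> and \<open>C = V\<close>, without the condition that \<open>Y\<close> meets \<open>C\<close>.

  The running time is bounded compositionally: functions that the machine computes in polynomial time, with
  respect to given encodings of arguments and results, are closed under the usual operations on lists,
  including iteration as long as the accumulator stays polynomially bounded.\<close>

section \<open>Polynomial bounds\<close>

text \<open>Component normal form is what makes the subproblems independent. Below a node with bag
  \<open>X\<close>, the subtree for \<open>C\<close> has vertex set \<open>C\<close> plus part of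
  \<open>X\<close>, and in the whole decomposition the vertices of \<open>C\<close> occur nowhere
  else. So exactly the edges meeting \<open>C\<close> must be covered there, and solutions for
  different components can be glued freely once the root bag passes the local condition.

  The root is exempt from meeting \<open>C\<close> because skipping a bag that misses
  \<open>C\<close> is argued only for components \<open>C\<close>. The vertex set of a disconnected
  hypergraph is not a component of the empty set, and that of the empty hypergraph is met by no bag
  at all.

  A machine value is charged with its full size, so a tree assembled from table entries pays for
  every copy of them; polynomially many rounds alone would not give polynomial time. Moreover, the
  time bounds range over all lists, whether or not they encode a hypergraph. Hence the facts about
  components that the size bounds rely on are proved without assuming
  \<open>hypergraph\<close>.\<close>

definition pbound :: "('a \<Rightarrow> nat) \<Rightarrow> ('a \<Rightarrow> nat) \<Rightarrow> bool" where
  "pbound m g \<longleftrightarrow> (\<exists>q::nat poly. \<forall>x. g x \<le> poly q (m x))"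

text \<open>Natural coefficients make every polynomial monotone; this is why an argument may be
  replaced by a larger one throughout the bounds.\<close>

lemma poly_nat_mono: "m \<le> n \<Longrightarrow> poly (q::nat poly) m \<le> poly q n"
  by (induction q) (auto intro: add_mono mult_mono)

lemma pbound_le: "pbound m g \<Longrightarrow> (\<And>x. f x \<le> g x) \<Longrightarrow> pbound m f"
  unfolding pbound_def by (meson order_trans)

lemma pbound_const: "pbound m (\<lambda>_. k)"
  unfolding pbound_def by (rule exI[of _ "[:k:]"]) simp

lemma pbound_self: "pbound m m"
  unfolding pbound_def by (rule exI[of _ "[:0, 1:]"]) simp

lemma pbound_add: "pbound m f \<Longrightarrow> pbound m g \<Longrightarrow> pbound m (\<lambda>x. f x + g x)"
  unfolding pbound_def by (metis add_mono poly_add)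

lemma pbound_mult: "pbound m f \<Longrightarrow> pbound m g \<Longrightarrow> pbound m (\<lambda>x. f x * g x)"
  unfolding pbound_def by (metis mult_le_mono poly_mult)

lemma pbound_Suc: "pbound m f \<Longrightarrow> pbound m (\<lambda>x. Suc (f x))"
  using pbound_add[OF _ pbound_const[of m 1]] by simp

lemma pbound_poly: "pbound m h \<Longrightarrow> pbound m (\<lambda>x. poly q (h x))"
  unfolding pbound_def by (metis poly_nat_mono poly_pcompose)

text \<open>Typical use: \<open>h\<close> computes an intermediate value and \<open>g\<close> is the
  cost of what follows, bounded in the size of that value, which is in turn bounded in the size of
  the input.\<close>

lemma pbound_compose:
  assumes "pbound m' g" "pbound m (\<lambda>x. m' (h x))" shows "pbound m (\<lambda>x. g (h x))"
  using assms(1) unfolding pbound_def[of m' g]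
  by (blast intro: pbound_le[OF pbound_poly[OF assms(2)]])

lemmas pbound_intros = pbound_add pbound_mult pbound_Suc pbound_const pbound_self

section \<open>Polynomial-time computable functions\<close>

text \<open>An upper bound instead of the exact time, so that costs can be rounded up along the
  way.\<close>

definition runs :: "com \<Rightarrow> store \<Rightarrow> nat \<Rightarrow> store \<Rightarrow> bool" where
  "runs c s T s' \<longleftrightarrow> (\<exists>t\<le>T. exec c s t s')"

lemma runs_mono: "runs c s T s' \<Longrightarrow> T \<le> T' \<Longrightarrow> runs c s T' s'"
  unfolding runs_def by (meson order_trans)

lemma runs_Assign: "runs (Assign x a) s (Suc (eval_cost a s)) (s(x := eval a s))"
  unfolding runs_def using exec_Assign by blast

lemma runs_Seq:
  "runs c1 s T1 s1 \<Longrightarrow> runs c2 s1 T2 s2 \<Longrightarrow> runs (Seq c1 c2) s (Suc (T1 + T2)) s2"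
  unfolding runs_def by (meson Suc_le_mono add_mono exec_Seq)

lemma runs_CondT:
  "eval a s \<noteq> Leaf \<Longrightarrow> runs c1 s T s' \<Longrightarrow> runs (Cond a c1 c2) s (Suc (eval_cost a s + T)) s'"
  unfolding runs_def by (meson Suc_le_mono add_left_mono exec_CondT)

lemma runs_CondF:
  "eval a s = Leaf \<Longrightarrow> runs c2 s T s' \<Longrightarrow> runs (Cond a c1 c2) s (Suc (eval_cost a s + T)) s'"
  unfolding runs_def by (meson Suc_le_mono add_left_mono exec_CondF)

lemma runs_WhileF: "eval a s = Leaf \<Longrightarrow> runs (While a c) s (Suc (eval_cost a s)) s"
  unfolding runs_def using exec_WhileF by blast

lemma runs_WhileT:
  "eval a s \<noteq> Leaf \<Longrightarrow> runs c s T1 s1 \<Longrightarrow> runs (While a c) s1 T2 s2 \<Longrightarrow>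
   runs (While a c) s (Suc (eval_cost a s + T1 + T2)) s2"
  unfolding runs_def by (meson Suc_le_mono add_left_mono add_mono exec_WhileT)

text \<open>The program may start with arbitrary values in all variables other than 0, and it leaves
  all variables above some \<open>N\<close> unchanged; so a compound program can keep intermediate results in
  variables above those of its parts.\<close>

definition implements ::
  "com \<Rightarrow> nat \<Rightarrow> ('a \<Rightarrow> nat) \<Rightarrow> ('a \<Rightarrow> tree) \<Rightarrow> ('b \<Rightarrow> tree) \<Rightarrow> ('a \<Rightarrow> 'b) \<Rightarrow> bool" where
  "implements c N T E F f \<longleftrightarrow>
     (\<forall>x s. s 0 = E x \<longrightarrow>
        (\<exists>s'. runs c s (T x) s' \<and> s' 0 = F (f x) \<and> (\<forall>v>N. s' v = s v)))"

lemma implementsI: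
  assumes "\<And>x s. s 0 = E x \<Longrightarrow> \<exists>s'. runs c s (T x) s' \<and> s' 0 = F (f x) \<and> (\<forall>v>N. s' v = s v)"
  shows "implements c N T E F f"
  using assms unfolding implements_def by blast

lemma implementsE:
  assumes "implements c N T E F f" "s 0 = E x"
  obtains s' where "runs c s (T x) s'" "s' 0 = F (f x)" "\<And>v. v > N \<Longrightarrow> s' v = s v"
  using assms unfolding implements_def by blast

text \<open>The bound on the result size is what makes the notion compose: the next program is
  polynomial in the size of that result.\<close>

definition polytime :: "('a \<Rightarrow> tree) \<Rightarrow> ('b \<Rightarrow> tree) \<Rightarrow> ('a \<Rightarrow> 'b) \<Rightarrow> bool" where
  "polytime E F f \<longleftrightarrow>
     (\<exists>c N T. implements c N T E F f \<and> pbound (\<lambda>x. tsize (E x)) T) \<and>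
     pbound (\<lambda>x. tsize (E x)) (\<lambda>x. tsize (F (f x)))"

lemma polytime_size: "polytime E F f \<Longrightarrow> pbound (\<lambda>x. tsize (E x)) (\<lambda>x. tsize (F (f x)))"
  by (simp add: polytime_def)

lemma polytime_obtain:
  assumes "polytime E F f"
  obtains c N T where "implements c N T E F f" "pbound (\<lambda>x. tsize (E x)) T"
  using assms unfolding polytime_def by blast

lemma polytimeI:
  assumes "implements c N T E F f" "pbound (\<lambda>x. tsize (E x)) T"
    "pbound (\<lambda>x. tsize (E x)) (\<lambda>x. tsize (F (f x)))"
  shows "polytime E F f"
  using assms unfolding polytime_def by blast

lemma polytime_exp:
  assumes "\<And>x s. s 0 = E x \<Longrightarrow> eval a s = F (f x) \<and> eval_cost a s \<le> C x"
    and C: "pbound (\<lambda>x. tsize (E x)) C" "pbound (\<lambda>x. tsize (E x)) (\<lambda>x. tsize (F (f x)))"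
  shows "polytime E F f"
proof (rule polytimeI)
  show "implements (Assign 0 a) 0 (\<lambda>x. Suc (C x)) E F f"
  proof (rule implementsI)
    fix x and s :: store assume "s 0 = E x"
    with assms(1)[of s x] show "\<exists>s'. runs (Assign 0 a) s (Suc (C x)) s' \<and> s' 0 = F (f x) \<and>
        (\<forall>v>0. s' v = s v)"
      using runs_mono[OF runs_Assign[of 0 a s]] by (intro exI[of _ "s(0 := eval a s)"]) auto
  qed
qed (use C pbound_Suc in auto)

text \<open>The function changes only the reading of the tree, so the machine merely copies variable
  0 to itself.\<close>

lemma polytime_recode: "(\<And>x. F (f x) = E x) \<Longrightarrow> polytime E F f"
  by (rule polytime_exp[where a = "Var 0" and C = "\<lambda>x. tsize (E x)"]) (auto intro: pbound_self)

lemma polytime_id: "polytime E E (\<lambda>x. x)"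
  by (rule polytime_recode) simp

lemma polytime_const: "polytime E F (\<lambda>_. k)"
proof -
  \<comment> \<open>Every fixed tree is the value of an expression without variables, so neither its
    value nor its cost depends on the store.\<close>
  have "\<exists>a m. \<forall>s::store. eval a s = u \<and> eval_cost a s = m" for u
  proof (induction u)
    case Leaf
    show ?case by (rule exI[of _ ELeaf]) auto
  next
    case (Branch l r)
    then obtain a m b n where "\<forall>s::store. eval a s = l \<and> eval_cost a s = m"
      "\<forall>s::store. eval b s = r \<and> eval_cost b s = n" by blast
    then show ?case by (intro exI[of _ "EBranch a b"]) auto
  qed
  then obtain a m where "\<forall>s::store. eval a s = F k \<and> eval_cost a s = m" by blast
  then show ?thesis
    by (intro polytime_exp[where a = a and C = "\<lambda>_. m"] pbound_const) auto
qed

lemma polytime_compose: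
  assumes f: "polytime E F f" and g: "polytime F G g"
  shows "polytime E G (\<lambda>x. g (f x))"
proof -
  obtain c N T where c: "implements c N T E F f" "pbound (\<lambda>x. tsize (E x)) T"
    using f by (rule polytime_obtain)
  obtain c' N' T' where c': "implements c' N' T' F G g" "pbound (\<lambda>x. tsize (F x)) T'"
    using g by (rule polytime_obtain)
  show ?thesis
  proof (rule polytimeI)
    show "implements (Seq c c') (max N N') (\<lambda>x. Suc (T x + T' (f x))) E G (\<lambda>x. g (f x))"
    proof (rule implementsI)
      fix x and s :: store assume "s 0 = E x"
      with c(1) obtain s1 where 1: "runs c s (T x) s1" "s1 0 = F (f x)" "\<And>v. v > N \<Longrightarrow> s1 v = s v"
        by (rule implementsE) blast
      from c'(1) 1(2) obtain s2 where 2: "runs c' s1 (T' (f x)) s2" "s2 0 = G (g (f x))"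
        "\<And>v. v > N' \<Longrightarrow> s2 v = s1 v"
        by (rule implementsE) blast
      show "\<exists>s'. runs (Seq c c') s (Suc (T x + T' (f x))) s' \<and> s' 0 = G (g (f x)) \<and>
          (\<forall>v>max N N'. s' v = s v)"
        using runs_Seq[OF 1(1) 2(1)] 1 2 by auto
    qed
    note size = polytime_size[OF f]
    show "pbound (\<lambda>x. tsize (E x)) (\<lambda>x. Suc (T x + T' (f x)))"
      by (intro pbound_intros c(2) pbound_compose[OF c'(2) size])
    show "pbound (\<lambda>x. tsize (E x)) (\<lambda>x. tsize (G (g (f x))))"
      by (rule pbound_compose[OF polytime_size[OF g] size])
  qed
qed

section \<open>Pairs, constructors and branching\<close>

fun enc_prod :: "('a \<Rightarrow> tree) \<Rightarrow> ('b \<Rightarrow> tree) \<Rightarrow> 'a \<times> 'b \<Rightarrow> tree" (infixr "\<otimes>" 80) where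
  "(E \<otimes> F) (x, y) = Branch (E x) (F y)"

lemma enc_prod_conv: "(E \<otimes> F) p = Branch (E (fst p)) (F (snd p))"
  by (cases p) simp

lemma inj_enc_prod: "inj E \<Longrightarrow> inj F \<Longrightarrow> inj (E \<otimes> F)"
  by (auto simp: inj_def enc_prod_conv)

lemma tsize_pos: "0 < tsize u"
  by (cases u) auto

lemma polytime_Pair:
  assumes f: "polytime E F f" and g: "polytime E G g"
  shows "polytime E (F \<otimes> G) (\<lambda>x. (f x, g x))"
proof -
  obtain c N T where c: "implements c N T E F f" "pbound (\<lambda>x. tsize (E x)) T"
    using f by (rule polytime_obtain)
  obtain c' N' T' where c': "implements c' N' T' E G g" "pbound (\<lambda>x. tsize (E x)) T'"
    using g by (rule polytime_obtain)
  \<comment> \<open>Both programs read variable 0. The input survives \<open>c\<close> in variable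
    \<open>i\<close>, and the first result survives \<open>c'\<close> in variable
    \<open>j\<close>.\<close>
  define i j where "i = Suc (max N N')" and "j = Suc i"
  then have ij: "N < i" "N' < i" "N < j" "N' < j" "i \<noteq> j" "i > 0" "j > 0" "max N N' < i" by auto
  let ?P = "Seq (Assign i (Var 0)) (Seq c (Seq (Assign j (Var 0)) (Seq (Assign 0 (Var i))
     (Seq c' (Assign 0 (EBranch (Var j) (Var 0)))))))"
  define B where "B x = 2 * tsize (E x) + T x + 3 * tsize (F (f x)) + T' x +
    3 * tsize (G (g x)) + 50" for x
  show ?thesis
  proof (rule polytimeI)
    show "implements ?P j B E (F \<otimes> G) (\<lambda>x. (f x, g x))"
    proof (rule implementsI)
      fix x and s :: store assume s: "s 0 = E x"
      then have "(s(i := s 0)) 0 = E x" using ij by simp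
      with c(1) obtain s1 where 1: "runs c (s(i := s 0)) (T x) s1" "s1 0 = F (f x)"
        "\<And>v. v > N \<Longrightarrow> s1 v = (s(i := s 0)) v"
        by (rule implementsE) blast
      define s2 where "s2 = s1(j := F (f x), 0 := s 0)"
      have "s2 0 = E x" using s by (simp add: s2_def)
      with c'(1) obtain s3 where 3: "runs c' s2 (T' x) s3" "s3 0 = G (g x)"
        "\<And>v. v > N' \<Longrightarrow> s3 v = s2 v"
        by (rule implementsE) blast
      have s3j: "s3 j = F (f x)" using 3 ij by (simp add: s2_def)
      have s1i: "s1 i = E x" using 1 ij s by simp
      have "runs ?P s (B x) (s3(0 := Branch (F (f x)) (G (g x))))"
      proof -
        have a: "runs (Assign i (Var 0)) s (Suc (tsize (E x))) (s(i := s 0))"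
          using runs_Assign[of i "Var 0" s] s by simp
        have b: "runs (Assign j (Var 0)) s1 (Suc (tsize (F (f x)))) (s1(j := F (f x)))"
          using runs_Assign[of j "Var 0" s1] 1 by simp
        have d: "runs (Assign 0 (Var i)) (s1(j := F (f x))) (Suc (tsize (E x))) s2"
          using runs_Assign[of 0 "Var i" "s1(j := F (f x))"] ij s1i s by (simp add: s2_def)
        have e: "runs (Assign 0 (EBranch (Var j) (Var 0))) s3
            (Suc (tsize (F (f x)) + tsize (G (g x)) + Suc (tsize (F (f x)) + tsize (G (g x)))))
            (s3(0 := Branch (F (f x)) (G (g x))))"
          using runs_Assign[of 0 "EBranch (Var j) (Var 0)" s3] 3 s3j by simp
        show ?thesis
          by (rule runs_mono[OF runs_Seq[OF a runs_Seq[OF 1(1) runs_Seq[OF b runs_Seq[OF d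
                    runs_Seq[OF 3(1) e]]]]]]) (simp add: B_def)
      qed
      moreover have "s3 v = s v" if "v > j" for v
        using 1(3)[of v] 3(3)[of v] that ij by (auto simp: s2_def j_def)
      ultimately show "\<exists>s'. runs ?P s (B x) s' \<and> s' 0 = (F \<otimes> G) (f x, g x) \<and> (\<forall>v>j. s' v = s v)"
        using ij by (intro exI[of _ "s3(0 := Branch (F (f x)) (G (g x)))"]) auto
    qed
    show "pbound (\<lambda>x. tsize (E x)) B"
      unfolding B_def by (intro pbound_intros c c' polytime_size[OF f] polytime_size[OF g])
    show "pbound (\<lambda>x. tsize (E x)) (\<lambda>x. tsize ((F \<otimes> G) (f x, g x)))"
      by (simp, intro pbound_intros polytime_size[OF f] polytime_size[OF g])
  qed
qed

lemma polytime_fst': "polytime (E \<otimes> F) E fst"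
proof (rule polytime_exp)
  show "eval (EHd (Var 0)) s = E (fst x) \<and>
      eval_cost (EHd (Var 0)) s \<le> tsize ((E \<otimes> F) x) + tsize ((E \<otimes> F) x)"
    if "s 0 = (E \<otimes> F) x" for s x
    using that by (simp add: enc_prod_conv)
  show "pbound (\<lambda>x. tsize ((E \<otimes> F) x)) (\<lambda>x. tsize (E (fst x)))"
    by (rule pbound_le[OF pbound_self]) (simp add: enc_prod_conv)
qed (intro pbound_intros)

lemma polytime_snd': "polytime (E \<otimes> F) F snd"
proof (rule polytime_exp)
  show "eval (ETl (Var 0)) s = F (snd x) \<and>
      eval_cost (ETl (Var 0)) s \<le> tsize ((E \<otimes> F) x) + tsize ((E \<otimes> F) x)"
    if "s 0 = (E \<otimes> F) x" for s x
    using that by (simp add: enc_prod_conv)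
  show "pbound (\<lambda>x. tsize ((E \<otimes> F) x)) (\<lambda>x. tsize (F (snd x)))"
    by (rule pbound_le[OF pbound_self]) (simp add: enc_prod_conv)
qed (intro pbound_intros)

lemma polytime_fst: "polytime E (F \<otimes> G) f \<Longrightarrow> polytime E F (\<lambda>x. fst (f x))"
  by (rule polytime_compose[OF _ polytime_fst'])

lemma polytime_snd: "polytime E (F \<otimes> G) f \<Longrightarrow> polytime E G (\<lambda>x. snd (f x))"
  by (rule polytime_compose[OF _ polytime_snd'])

lemma polytime_app2:
  assumes "polytime (A \<otimes> B) R (\<lambda>p. h (fst p) (snd p))" "polytime E A a" "polytime E B b"
  shows "polytime E R (\<lambda>x. h (a x) (b x))"
  using polytime_compose[OF polytime_Pair[OF assms(2,3)] assms(1)] by simp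

text \<open>A constructor encoded as a \<open>Branch\<close> of its two arguments is, for the
  machine, just the forming of a pair.\<close>

lemma polytime_recode2:
  assumes "\<And>x y. R (h x y) = Branch (A x) (B y)" "polytime E A a" "polytime E B b"
  shows "polytime E R (\<lambda>x. h (a x) (b x))"
  by (rule polytime_app2[OF polytime_recode assms(2,3)]) (simp add: assms(1) enc_prod_conv)

lemma polytime_Cons:
  "polytime E A f \<Longrightarrow> polytime E (enc_list A) g \<Longrightarrow> polytime E (enc_list A) (\<lambda>x. f x # g x)"
  by (rule polytime_recode2) simp_all

lemma enc_rtree_Node: "enc_rtree f (Node b ts) = Branch (f b) (enc_list (enc_rtree f) ts)"
  by (simp add: enc_list_map)

lemma polytime_Node:
  "polytime E A f \<Longrightarrow> polytime E (enc_list (enc_rtree A)) g \<Longrightarrow>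
   polytime E (enc_rtree A) (\<lambda>x. Node (f x) (g x))"
  by (rule polytime_recode2) (simp_all only: enc_rtree_Node)

lemma polytime_Some:
  assumes "polytime E A f" shows "polytime E (enc_option A) (\<lambda>x. Some (f x))"
  \<comment> \<open>The encoding of \<open>Some\<close> is a pair with \<open>Leaf\<close> on the
    left, so \<open>Some\<close> is treated as a binary constructor with a dummy argument of type
    \<open>unit\<close>.\<close>
  using polytime_recode2[where R = "enc_option A" and h = "\<lambda>_::unit. Some" and A = "\<lambda>_. Leaf"
      and a = "\<lambda>_. ()", OF _ polytime_const assms] by simp

lemma tsize_tree_of_bool_le: "tsize (tree_of_bool b) \<le> 3"
  by (simp add: tree_of_bool_def)

text \<open>The machine compares encodings, which decides equality of the values only for an
  injective encoding. All later injectivity conditions stem from here.\<close>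

lemma polytime_eq:
  assumes "polytime E A f" "polytime E A g" "inj A"
  shows "polytime E tree_of_bool (\<lambda>x. f x = g x)"
proof -
  have "polytime (A \<otimes> A) tree_of_bool (\<lambda>p. fst p = snd p)"
  proof (rule polytime_exp)
    show "eval (EEqual (EHd (Var 0)) (ETl (Var 0))) s = tree_of_bool (fst x = snd x) \<and>
        eval_cost (EEqual (EHd (Var 0)) (ETl (Var 0))) s \<le> 4 * tsize ((A \<otimes> A) x) + 3"
      if "s 0 = (A \<otimes> A) x" for s x
      using that by (simp add: enc_prod_conv inj_eq[OF assms(3)] tree_of_bool_def)
    show "pbound (\<lambda>x. tsize ((A \<otimes> A) x)) (\<lambda>x. tsize (tree_of_bool (fst x = snd x)))"
      by (rule pbound_le[OF pbound_const tsize_tree_of_bool_le])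
  qed (intro pbound_intros)
  then show ?thesis by (rule polytime_app2) fact+
qed

text \<open>\<open>None\<close> is encoded by \<open>Leaf\<close>, the false value of the machine,
  so an encoded option can itself serve as the test.\<close>

lemma polytime_case_option:
  assumes k: "polytime E (enc_option A) k" and n: "polytime E B n"
    and h: "polytime (E \<otimes> A) B (\<lambda>p. h (fst p) (snd p))"
  shows "polytime E B (\<lambda>x. case k x of None \<Rightarrow> n x | Some y \<Rightarrow> h x y)"
proof -
  obtain c1 N1 T1 where c1: "implements c1 N1 T1 E (enc_option A) k" "pbound (\<lambda>x. tsize (E x)) T1"
    using k by (rule polytime_obtain)
  obtain c2 N2 T2 where c2: "implements c2 N2 T2 E B n" "pbound (\<lambda>x. tsize (E x)) T2"
    using n by (rule polytime_obtain)
  obtain c3 N3 T3 where c3: "implements c3 N3 T3 (E \<otimes> A) B (\<lambda>p. h (fst p) (snd p))"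
    "pbound (\<lambda>x. tsize ((E \<otimes> A) x)) T3"
    using h by (rule polytime_obtain)
  define i where "i = Suc (max N1 (max N2 N3))"
  then have i: "N1 < i" "N2 < i" "N3 < i" "i > 0" by auto
  let ?K = "Cond (Var 0) (Seq (Assign 0 (EBranch (Var i) (ETl (Var 0)))) c3)
    (Seq (Assign 0 (Var i)) c2)"
  let ?P = "Seq (Assign i (Var 0)) (Seq c1 ?K)"
  obtain q where q: "T3 p \<le> poly q (tsize ((E \<otimes> A) p))" for p
    using c3(2) unfolding pbound_def by blast
  obtain r where r: "tsize (B (h (fst p) (snd p))) \<le> poly r (tsize ((E \<otimes> A) p))" for p
    using polytime_size[OF h] unfolding pbound_def by blast
  \<comment> \<open>\<open>M x\<close> bounds the pair handed to \<open>c3\<close> whatever the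
    payload \<open>y\<close> is; evaluating \<open>q\<close> and \<open>r\<close> there gives bounds
    that depend on \<open>x\<close> alone.\<close>
  define M where "M x = tsize (E x) + tsize (enc_option A (k x)) + 1" for x
  have M: "pbound (\<lambda>x. tsize (E x)) M"
    unfolding M_def by (intro pbound_intros polytime_size[OF k])
  have leM: "tsize ((E \<otimes> A) (x, y)) \<le> M x" if "k x = Some y" for x y
    using that by (simp add: M_def)
  have q': "T3 (x, y) \<le> poly q (M x)" if "k x = Some y" for x y
    using q[of "(x, y)"] poly_nat_mono[OF leM[OF that], of q] by linarith
  define T where "T x = 6 * M x + T1 x + T2 x + poly q (M x) + 50" for x
  show ?thesis
  proof (rule polytimeI)
    show "implements ?P i T E B (\<lambda>x. case k x of None \<Rightarrow> n x | Some y \<Rightarrow> h x y)"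
    proof (rule implementsI)
      fix x and s :: store assume s: "s 0 = E x"
      then have "(s(i := s 0)) 0 = E x" using i by simp
      with c1(1) obtain s1 where 1: "runs c1 (s(i := s 0)) (T1 x) s1" "s1 0 = enc_option A (k x)"
        "\<And>v. v > N1 \<Longrightarrow> s1 v = (s(i := s 0)) v"
        by (rule implementsE) blast
      have s1i: "s1 i = E x" using 1 i s by simp
      have a: "runs (Assign i (Var 0)) s (Suc (tsize (E x))) (s(i := s 0))"
        using runs_Assign[of i "Var 0" s] s by simp
      have "\<exists>s'. runs ?K s1 (5 * M x + T2 x + poly q (M x) + 40) s' \<and>
          s' 0 = B (case k x of None \<Rightarrow> n x | Some y \<Rightarrow> h x y) \<and> (\<forall>v>i. s' v = s1 v)"
      proof (cases "k x")
        case None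
        have "(s1(0 := E x)) 0 = E x" by simp
        with c2(1) obtain s3 where 3: "runs c2 (s1(0 := E x)) (T2 x) s3" "s3 0 = B (n x)"
          "\<And>v. v > N2 \<Longrightarrow> s3 v = (s1(0 := E x)) v"
          by (rule implementsE) blast
        have b: "runs (Assign 0 (Var i)) s1 (Suc (tsize (E x))) (s1(0 := E x))"
          using runs_Assign[of 0 "Var i" s1] s1i by simp
        have "runs ?K s1 (Suc (eval_cost (Var 0) s1 + Suc (Suc (tsize (E x)) + T2 x))) s3"
          by (rule runs_CondF[OF _ runs_Seq[OF b 3(1)]]) (simp add: 1 None)
        then have "runs ?K s1 (5 * M x + T2 x + poly q (M x) + 40) s3"
          by (rule runs_mono) (simp add: M_def 1 None)
        then show ?thesis using 3 None i by auto
      next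
        case (Some y)
        define s2 where "s2 = s1(0 := Branch (E x) (A y))"
        have "s2 0 = (E \<otimes> A) (x, y)" by (simp add: s2_def)
        with c3(1) obtain s3 where 3: "runs c3 s2 (T3 (x, y)) s3"
          "s3 0 = B (h (fst (x, y)) (snd (x, y)))" "\<And>v. v > N3 \<Longrightarrow> s3 v = s2 v"
          by (rule implementsE) blast
        have b: "runs (Assign 0 (EBranch (Var i) (ETl (Var 0)))) s1 (4 * M x + 2) s2"
          by (rule runs_mono[OF runs_Assign[of 0 "EBranch (Var i) (ETl (Var 0))" s1,
                  simplified 1 s1i eval.simps, simplified Some enc_option.simps tl_tree.simps,
                  folded s2_def]])
             (simp add: M_def s1i 1 Some)
        have "runs ?K s1 (Suc (eval_cost (Var 0) s1 + Suc ((4 * M x + 2) + T3 (x, y)))) s3"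
          by (rule runs_CondT[OF _ runs_Seq[OF b 3(1)]]) (simp add: 1 Some)
        then have "runs ?K s1 (5 * M x + T2 x + poly q (M x) + 40) s3"
          by (rule runs_mono) (use q'[OF Some] in \<open>simp add: M_def 1 Some\<close>)
        then show ?thesis using 3 Some i by (auto simp: s2_def)
      qed
      then obtain s' where s': "runs ?K s1 (5 * M x + T2 x + poly q (M x) + 40) s'"
        "s' 0 = B (case k x of None \<Rightarrow> n x | Some y \<Rightarrow> h x y)" "\<And>v. v > i \<Longrightarrow> s' v = s1 v" by blast
      have "runs ?P s (Suc (Suc (tsize (E x)) + Suc (T1 x + (5 * M x + T2 x + poly q (M x) + 40)))) s'"
        by (rule runs_Seq[OF a runs_Seq[OF 1(1) s'(1)]])
      then have "runs ?P s (T x) s'"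
        by (rule runs_mono) (simp add: T_def M_def)
      then show "\<exists>s'. runs ?P s (T x) s' \<and>
          s' 0 = B (case k x of None \<Rightarrow> n x | Some y \<Rightarrow> h x y) \<and> (\<forall>v>i. s' v = s v)"
        using s' 1(3) i by auto
    qed
    show "pbound (\<lambda>x. tsize (E x)) T"
      unfolding T_def by (intro pbound_intros pbound_poly M c1 c2)
    show "pbound (\<lambda>x. tsize (E x)) (\<lambda>x. tsize (B (case k x of None \<Rightarrow> n x | Some y \<Rightarrow> h x y)))"
    proof (rule pbound_le)
      show "pbound (\<lambda>x. tsize (E x)) (\<lambda>x. tsize (B (n x)) + poly r (M x))"
        by (intro pbound_intros polytime_size[OF n] pbound_poly M)
      show "tsize (B (case k x of None \<Rightarrow> n x | Some y \<Rightarrow> h x y)) \<le> tsize (B (n x)) + poly r (M x)" for x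
      proof (cases "k x")
        case (Some y)
        then show ?thesis using r[of "(x, y)"] poly_nat_mono[OF leM[OF Some], of r] by simp
      qed simp
    qed
  qed
qed

text \<open>Truth values and options of type \<open>unit\<close> have the same encodings, so
  \<open>if\<close> is a case distinction on an option.\<close>

lemma polytime_if:
  assumes "polytime E tree_of_bool b" "polytime E B f" "polytime E B g"
  shows "polytime E B (\<lambda>x. if b x then f x else g x)"
proof -
  let ?k = "\<lambda>x. if b x then Some () else None"
  have "polytime E (enc_option (\<lambda>_. Leaf)) ?k"
    by (rule polytime_compose[OF assms(1) polytime_recode]) (simp add: tree_of_bool_def)
  then have "polytime E B (\<lambda>x. case ?k x of None \<Rightarrow> g x | Some _ \<Rightarrow> f x)"
    by (rule polytime_case_option[OF _ assms(3) polytime_compose[OF polytime_fst' assms(2)]])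
  moreover have "(\<lambda>x. case ?k x of None \<Rightarrow> g x | Some _ \<Rightarrow> f x) = (\<lambda>x. if b x then f x else g x)"
    by auto
  ultimately show ?thesis by simp
qed

lemma polytime_conj:
  assumes "polytime E tree_of_bool b" "polytime E tree_of_bool c"
  shows "polytime E tree_of_bool (\<lambda>x. b x \<and> c x)"
proof -
  have "polytime E tree_of_bool (\<lambda>x. if b x then c x else False)"
    by (intro polytime_if polytime_const assms)
  then show ?thesis by (rule back_subst[of "polytime E tree_of_bool"]) auto
qed

lemma polytime_disj:
  assumes "polytime E tree_of_bool b" "polytime E tree_of_bool c"
  shows "polytime E tree_of_bool (\<lambda>x. b x \<or> c x)"
proof -
  have "polytime E tree_of_bool (\<lambda>x. if b x then True else c x)"
    by (intro polytime_if polytime_const assms)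
  then show ?thesis by (rule back_subst[of "polytime E tree_of_bool"]) auto
qed

lemma polytime_not:
  assumes "polytime E tree_of_bool b" shows "polytime E tree_of_bool (\<lambda>x. \<not> b x)"
proof -
  have "polytime E tree_of_bool (\<lambda>x. if b x then False else True)"
    by (intro polytime_if polytime_const assms)
  then show ?thesis by (rule back_subst[of "polytime E tree_of_bool"]) auto
qed

section \<open>Recursion over lists\<close>

lemma tsize_enc_list: "tsize (enc_list A xs) = Suc (\<Sum>x\<leftarrow>xs. Suc (tsize (A x)))"
  by (induction xs) auto

lemma length_le_tsize: "length xs \<le> tsize (enc_list A xs)"
  by (induction xs) auto

lemma tsize_elem_le: "x \<in> set xs \<Longrightarrow> tsize (A x) \<le> tsize (enc_list A xs)"
  by (induction xs) auto

text \<open>The loop keeps the parameter \<open>x\<close>, the rest of the list and the accumulator in the variables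
  \<open>i\<close>, \<open>i + 1\<close> and \<open>i + 2\<close>.\<close>

lemma runs_fold_loop:
  fixes s :: store
  assumes c: "implements c N T (E \<otimes> A \<otimes> B) B (\<lambda>p. h (fst p) (fst (snd p)) (snd (snd p)))"
    and q: "\<And>p. T p \<le> poly q (tsize ((E \<otimes> A \<otimes> B) p))"
    and i: "N < i"
    and s: "s i = E x" "s (i + 1) = enc_list A ys" "s (i + 2) = B acc"
    and M: "tsize (E x) \<le> M" "tsize (enc_list A ys) \<le> M"
      "\<And>k. k \<le> length ys \<Longrightarrow> tsize (B (fold (h x) (take k ys) acc)) \<le> M"
  shows "\<exists>s'. runs (While (Var (i + 1))
            (Seq (Assign 0 (EBranch (Var i) (EBranch (EHd (Var (i + 1))) (Var (i + 2)))))
              (Seq c (Seq (Assign (i + 2) (Var 0)) (Assign (i + 1) (ETl (Var (i + 1))))))))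
          s (Suc (length ys) * (poly q (3 * M + 2) + 20 * M + 20)) s' \<and>
        s' (i + 2) = B (fold (h x) ys acc) \<and> (\<forall>v>i + 2. s' v = s v)"
    (is "\<exists>s'. runs (While _ ?body) s _ s' \<and> _")
  using s M
proof (induction ys arbitrary: s acc)
  case Nil
  have "runs (While (Var (i + 1)) ?body) s 2 s"
    using runs_WhileF[of "Var (i + 1)" s ?body] Nil by (simp add: numeral_2_eq_2)
  then have "runs (While (Var (i + 1)) ?body) s
      (Suc (length []) * (poly q (3 * M + 2) + 20 * M + 20)) s"
    by (rule runs_mono) simp
  then show ?case using Nil by auto
next
  case (Cons y ys)
  \<comment> \<open>One round calls \<open>c\<close> on a triple of size at most
    \<open>3 * M + 2\<close>: three parts of size at most \<open>M\<close> and two branch nodes. The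
    rest pays for the test and the assignments, rounded up. Since \<open>M\<close> stays fixed in
    the induction, all rounds have the same bound.\<close>
  let ?K = "poly q (3 * M + 2) + 20 * M + 20"
  have My: "tsize (A y) + tsize (enc_list A ys) < M" using Cons.prems(5) by simp
  have Macc: "tsize (B acc) \<le> M" using Cons.prems(6)[of 0] by simp
  have Mh: "tsize (B (h x y acc)) \<le> M" using Cons.prems(6)[of 1] by simp
  define u where "u = Branch (E x) (Branch (A y) (B acc))"
  have u: "tsize u \<le> 3 * M + 2" using My Macc Cons.prems(4) by (simp add: u_def)
  have "(s(0 := u)) 0 = (E \<otimes> A \<otimes> B) (x, y, acc)" by (simp add: u_def)
  with c obtain s1 where 1: "runs c (s(0 := u)) (T (x, y, acc)) s1"
    "s1 0 = B (h (fst (x, y, acc)) (fst (snd (x, y, acc))) (snd (snd (x, y, acc))))"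
    "\<And>v. v > N \<Longrightarrow> s1 v = (s(0 := u)) v"
    by (rule implementsE) blast
  have "T (x, y, acc) \<le> poly q (3 * M + 2)"
    using q[of "(x, y, acc)"] poly_nat_mono[OF u, of q] by (simp add: u_def)
  note 1 = runs_mono[OF 1(1) this] 1(2,3)
  let ?a = "EBranch (Var i) (EBranch (EHd (Var (i + 1))) (Var (i + 2)))"
  have a: "runs (Assign 0 ?a) s (14 * M + 10) (s(0 := u))"
    using runs_mono[OF runs_Assign[of 0 ?a s], of "14 * M + 10"] Cons.prems(1-5) My Macc
    by (simp add: u_def)
  let ?s2 = "s1(i + 2 := B (h x y acc))" and ?s3 = "s1(i + 2 := B (h x y acc), i + 1 := enc_list A ys)"
  have s1: "s1 0 = B (h x y acc)" "s1 (i + 1) = Branch (A y) (enc_list A ys)" "s1 i = E x"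
    using 1(2,3) i Cons.prems by simp_all
  have b: "runs (Assign (i + 2) (Var 0)) s1 (M + 1) ?s2"
    using runs_mono[OF runs_Assign[of "i + 2" "Var 0" s1], of "M + 1"] s1 Mh by simp
  have d: "runs (Assign (i + 1) (ETl (Var (i + 1)))) ?s2 (3 * M + 3) ?s3"
    using runs_mono[OF runs_Assign[of "i + 1" "ETl (Var (i + 1))" ?s2], of "3 * M + 3"] s1 My by simp
  have "\<exists>s'. runs (While (Var (i + 1)) ?body) ?s3 (Suc (length ys) * ?K) s' \<and>
      s' (i + 2) = B (fold (h x) ys (h x y acc)) \<and> (\<forall>v>i + 2. s' v = ?s3 v)"
  proof (rule Cons.IH)
    show "tsize (B (fold (h x) (take k ys) (h x y acc))) \<le> M" if "k \<le> length ys" for k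
      using Cons.prems(6)[of "Suc k"] that by simp
  qed (use s1 My Cons.prems(4) in auto)
  then obtain s' where s': "runs (While (Var (i + 1)) ?body) ?s3 (Suc (length ys) * ?K) s'"
    "s' (i + 2) = B (fold (h x) ys (h x y acc))" "\<And>v. v > i + 2 \<Longrightarrow> s' v = ?s3 v" by blast
  have "runs (While (Var (i + 1)) ?body) s (Suc (length (y # ys)) * ?K) s'"
    by (rule runs_mono[OF runs_WhileT[OF _ runs_Seq[OF a runs_Seq[OF 1(1) runs_Seq[OF b d]]] s'(1)]])
      (use Cons.prems My in auto)
  moreover have "s' v = s v" if "v > i + 2" for v
    using that s'(3)[of v] 1(3)[of v] i by simp
  ultimately show ?case using s'(2) by auto
qed

text \<open>Iterating a polynomial-time step need not be polynomial, as the accumulator could double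
  in every round. Hence \<open>bd\<close>: one polynomial bound for all intermediate accumulators.
  Then all rounds obey one cost bound, and there are at most as many rounds as the size of the
  encoded list.\<close>

lemma polytime_fold:
  assumes k: "polytime E (enc_list A) k" and a: "polytime E B a"
    and h: "polytime (E \<otimes> A \<otimes> B) B (\<lambda>p. h (fst p) (fst (snd p)) (snd (snd p)))"
    and bd: "pbound (\<lambda>x. tsize (E x)) g"
      "\<And>x j. j \<le> length (k x) \<Longrightarrow> tsize (B (fold (h x) (take j (k x)) (a x))) \<le> g x"
  shows "polytime E B (\<lambda>x. fold (h x) (k x) (a x))"
proof -
  obtain c1 N1 T1 where c1: "implements c1 N1 T1 E (enc_list A) k" "pbound (\<lambda>x. tsize (E x)) T1"
    using k by (rule polytime_obtain)
  obtain c2 N2 T2 where c2: "implements c2 N2 T2 E B a" "pbound (\<lambda>x. tsize (E x)) T2"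
    using a by (rule polytime_obtain)
  obtain c3 N3 T3 where c3:
    "implements c3 N3 T3 (E \<otimes> A \<otimes> B) B (\<lambda>p. h (fst p) (fst (snd p)) (snd (snd p)))"
    "pbound (\<lambda>x. tsize ((E \<otimes> A \<otimes> B) x)) T3"
    using h by (rule polytime_obtain)
  define i where "i = Suc (max N1 (max N2 N3))"
  then have i: "N1 < i" "N2 < i" "N3 < i" "i > 0" by auto
  let ?body = "Seq (Assign 0 (EBranch (Var i) (EBranch (EHd (Var (i + 1))) (Var (i + 2)))))
              (Seq c3 (Seq (Assign (i + 2) (Var 0)) (Assign (i + 1) (ETl (Var (i + 1))))))"
  let ?P = "Seq (Assign i (Var 0)) (Seq c1 (Seq (Assign (i + 1) (Var 0)) (Seq (Assign 0 (Var i))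
    (Seq c2 (Seq (Assign (i + 2) (Var 0)) (Seq (While (Var (i + 1)) ?body) (Assign 0 (Var (i + 2)))))))))"
  obtain q where q: "T3 p \<le> poly q (tsize ((E \<otimes> A \<otimes> B) p))" for p
    using c3(2) unfolding pbound_def by blast
  define M where "M x = tsize (E x) + tsize (enc_list A (k x)) + g x" for x
  have M: "pbound (\<lambda>x. tsize (E x)) M"
    unfolding M_def by (intro pbound_intros polytime_size[OF k] bd(1))
  define W where "W x = Suc (M x) * (poly q (3 * M x + 2) + 20 * M x + 20)" for x
  define T where "T x = 10 * M x + T1 x + T2 x + W x + 50" for x
  show ?thesis
  proof (rule polytimeI)
    show "implements ?P (i + 2) T E B (\<lambda>x. fold (h x) (k x) (a x))"
    proof (rule implementsI)
      fix x and s :: store assume s: "s 0 = E x"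
      then have "(s(i := s 0)) 0 = E x" using i by simp
      with c1(1) obtain s1 where 1: "runs c1 (s(i := s 0)) (T1 x) s1" "s1 0 = enc_list A (k x)"
        "\<And>v. v > N1 \<Longrightarrow> s1 v = (s(i := s 0)) v"
        by (rule implementsE) blast
      have s1i: "s1 i = E x" using 1 i s by simp
      have r1: "runs (Assign i (Var 0)) s (M x + 1) (s(i := s 0))"
        using runs_mono[OF runs_Assign[of i "Var 0" s], of "M x + 1"] s by (simp add: M_def)
      let ?s2 = "s1(i + 1 := enc_list A (k x))"
      have r2: "runs (Assign (i + 1) (Var 0)) s1 (M x + 1) ?s2"
        using runs_mono[OF runs_Assign[of "i + 1" "Var 0" s1], of "M x + 1"] 1 by (simp add: M_def)
      define s3 where "s3 = s1(i + 1 := enc_list A (k x), 0 := E x)"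
      have r3: "runs (Assign 0 (Var i)) ?s2 (M x + 1) s3"
        using runs_mono[OF runs_Assign[of 0 "Var i" ?s2], of "M x + 1"] s1i by (simp add: M_def s3_def)
      have "s3 0 = E x" by (simp add: s3_def)
      with c2(1) obtain s4 where 4: "runs c2 s3 (T2 x) s4" "s4 0 = B (a x)"
        "\<And>v. v > N2 \<Longrightarrow> s4 v = s3 v"
        by (rule implementsE) blast
      define s5 where "s5 = s4(i + 2 := B (a x))"
      have Ba: "tsize (B (a x)) \<le> M x" using bd(2)[of 0 x] by (simp add: M_def)
      have r5: "runs (Assign (i + 2) (Var 0)) s4 (M x + 1) s5"
        using runs_mono[OF runs_Assign[of "i + 2" "Var 0" s4], of "M x + 1"] 4 Ba by (simp add: s5_def)
      have s5: "s5 i = E x" "s5 (i + 1) = enc_list A (k x)" "s5 (i + 2) = B (a x)"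
        using 4(3) i s1i by (simp_all add: s5_def s3_def)
      have "\<exists>s'. runs (While (Var (i + 1)) ?body) s5
          (Suc (length (k x)) * (poly q (3 * M x + 2) + 20 * M x + 20)) s' \<and>
          s' (i + 2) = B (fold (h x) (k x) (a x)) \<and> (\<forall>v>i + 2. s' v = s5 v)"
      proof (rule runs_fold_loop[OF c3(1) q i(3) s5])
        show "tsize (B (fold (h x) (take j (k x)) (a x))) \<le> M x" if "j \<le> length (k x)" for j
          using bd(2)[OF that] by (simp add: M_def)
      qed (simp_all add: M_def)
      then obtain s6 where 6: "runs (While (Var (i + 1)) ?body) s5
          (Suc (length (k x)) * (poly q (3 * M x + 2) + 20 * M x + 20)) s6"
        "s6 (i + 2) = B (fold (h x) (k x) (a x))" "\<And>v. v > i + 2 \<Longrightarrow> s6 v = s5 v" by blast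
      have "length (k x) \<le> M x" using length_le_tsize[of "k x" A] by (simp add: M_def)
      then have "Suc (length (k x)) * (poly q (3 * M x + 2) + 20 * M x + 20) \<le> W x"
        unfolding W_def by (intro mult_le_mono) auto
      note r6 = runs_mono[OF 6(1) this]
      let ?s7 = "s6(0 := B (fold (h x) (k x) (a x)))"
      have "tsize (B (fold (h x) (k x) (a x))) \<le> M x" using bd(2)[of "length (k x)" x] by (simp add: M_def)
      then have r7: "runs (Assign 0 (Var (i + 2))) s6 (M x + 1) ?s7"
        using runs_mono[OF runs_Assign[of 0 "Var (i + 2)" s6], of "M x + 1"] 6 by simp
      have "runs ?P s (T x) ?s7"
        by (rule runs_mono[OF runs_Seq[OF r1 runs_Seq[OF 1(1) runs_Seq[OF r2 runs_Seq[OF r3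
                  runs_Seq[OF 4(1) runs_Seq[OF r5 runs_Seq[OF r6 r7]]]]]]]])
          (simp add: T_def)
      moreover have "?s7 v = s v" if "v > i + 2" for v
        using that 6(3)[of v] 4(3)[of v] 1(3)[of v] i by (simp add: s5_def s3_def)
      ultimately show "\<exists>s'. runs ?P s (T x) s' \<and> s' 0 = B (fold (h x) (k x) (a x)) \<and>
          (\<forall>v>i + 2. s' v = s v)"
        by (intro exI[of _ ?s7]) auto
    qed
    show "pbound (\<lambda>x. tsize (E x)) T"
      unfolding T_def W_def by (intro pbound_intros pbound_poly M c1 c2)
    show "pbound (\<lambda>x. tsize (E x)) (\<lambda>x. tsize (B (fold (h x) (k x) (a x))))"
      by (rule pbound_le[OF bd(1)]) (use bd(2)[OF order_refl] in simp)
  qed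
qed

text \<open>If each round adds an amount that does not depend on the accumulator, the growth sums to
  at most the number of rounds times that amount. This covers every loop of the algorithm except the
  iteration of the table.\<close>

lemma polytime_fold_additive:
  assumes k: "polytime E (enc_list A) k" and a: "polytime E B a"
    and h: "polytime (E \<otimes> A \<otimes> B) B (\<lambda>p. h (fst p) (fst (snd p)) (snd (snd p)))"
    and g: "pbound (\<lambda>x. tsize (E x)) g"
      "\<And>x y acc. y \<in> set (k x) \<Longrightarrow> tsize (B (h x y acc)) \<le> tsize (B acc) + g x"
  shows "polytime E B (\<lambda>x. fold (h x) (k x) (a x))"
proof (rule polytime_fold[OF k a h])
  show "pbound (\<lambda>x. tsize (E x)) (\<lambda>x. tsize (B (a x)) + tsize (enc_list A (k x)) * g x)"
    by (intro pbound_intros polytime_size[OF a] polytime_size[OF k] g)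
  fix x j
  have "tsize (B (fold (h x) ys acc)) \<le> tsize (B acc) + length ys * g x"
    if "set ys \<subseteq> set (k x)" for ys acc
    using that
  proof (induction ys arbitrary: acc)
    case (Cons y ys)
    then have "tsize (B (fold (h x) ys (h x y acc))) \<le> tsize (B (h x y acc)) + length ys * g x"
      using Cons.IH[of "h x y acc"] by simp
    then show ?case using g(2)[of y x acc] Cons.prems by simp
  qed simp
  from this[OF set_take_subset] have "tsize (B (fold (h x) (take j (k x)) (a x))) \<le>
      tsize (B (a x)) + length (take j (k x)) * g x" .
  also have "\<dots> \<le> tsize (B (a x)) + tsize (enc_list A (k x)) * g x"
    using length_le_tsize[of "k x" A] by (intro add_left_mono mult_le_mono1) (simp add: min.coboundedI1)
  finally show "tsize (B (fold (h x) (take j (k x)) (a x))) \<le> \<dots>" .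
qed

text \<open>An element is no larger than its list, so a bound in the size of the pair
  \<open>(x, y)\<close> becomes one in the size of \<open>x\<close>.\<close>

lemma pbound_elem:
  assumes k: "polytime E (enc_list A) k" and f: "polytime (E \<otimes> A) B (\<lambda>p. f (fst p) (snd p))"
  shows "\<exists>g. pbound (\<lambda>x. tsize (E x)) g \<and> (\<forall>x. \<forall>y\<in>set (k x). tsize (B (f x y)) \<le> g x)"
proof -
  obtain q where q: "tsize (B (f (fst p) (snd p))) \<le> poly q (tsize ((E \<otimes> A) p))" for p
    using polytime_size[OF f] unfolding pbound_def by blast
  have "pbound (\<lambda>x. tsize (E x)) (\<lambda>x. poly q (tsize (E x) + tsize (enc_list A (k x)) + 1))"
    by (intro pbound_intros pbound_poly polytime_size[OF k])
  moreover have "tsize (B (f x y)) \<le> poly q (tsize (E x) + tsize (enc_list A (k x)) + 1)"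
    if "y \<in> set (k x)" for x y
  proof -
    have "tsize ((E \<otimes> A) (x, y)) \<le> tsize (E x) + tsize (enc_list A (k x)) + 1"
      using tsize_elem_le[OF that, of A] by simp
    from q[of "(x, y)"] poly_nat_mono[OF this, of q] show ?thesis by simp
  qed
  ultimately show ?thesis by blast
qed

section \<open>List functions as folds with bounded growth\<close>

lemmas polytime_basic = polytime_id polytime_const polytime_Pair polytime_fst polytime_snd
  polytime_Cons polytime_Node polytime_Some polytime_eq polytime_if polytime_conj polytime_disj
  polytime_not polytime_case_option

text \<open>A step of a fold receives the accumulator as third component; this lifts functions that
  do not read it.\<close>

lemma polytime_weaken: "polytime (E \<otimes> A) B (\<lambda>p. f (fst p) (snd p)) \<Longrightarrow>
   polytime (E \<otimes> A \<otimes> C) B (\<lambda>p. f (fst p) (fst (snd p)))"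
  by (erule polytime_app2) (rule polytime_basic)+

lemma polytime_rev:
  assumes "polytime E (enc_list A) k" shows "polytime E (enc_list A) (\<lambda>x. rev (k x))"
proof -
  obtain g where g: "pbound (\<lambda>x. tsize (E x)) g \<and> (\<forall>x. \<forall>y \<in> set (k x). tsize (A y) \<le> g x)"
    using pbound_elem[OF assms, where f = "\<lambda>_ y. y", OF polytime_snd'] ..
  then have g': "\<And>x y. y \<in> set (k x) \<Longrightarrow> tsize (A y) \<le> g x" by simp
  note g = conjunct1[OF g] g'
  have "polytime E (enc_list A) (\<lambda>x. fold Cons (k x) [])"
  proof (rule polytime_fold_additive[OF assms])
    show "pbound (\<lambda>x. tsize (E x)) (\<lambda>x. Suc (g x))" by (intro pbound_intros g)
    show "tsize (enc_list A (y # acc)) \<le> tsize (enc_list A acc) + Suc (g x)" if "y \<in> set (k x)" for x y acc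
      using g(2)[OF that] by simp
  qed (rule polytime_basic)+
  then show ?thesis by (simp add: fold_Cons_rev)
qed

lemma polytime_map:
  assumes k: "polytime E (enc_list A) k" and f: "polytime (E \<otimes> A) B (\<lambda>p. f (fst p) (snd p))"
  shows "polytime E (enc_list B) (\<lambda>x. map (f x) (k x))"
proof -
  obtain g where g: "pbound (\<lambda>x. tsize (E x)) g \<and> (\<forall>x. \<forall>y \<in> set (k x). tsize (B (f x y)) \<le> g x)"
    using pbound_elem[OF k f] ..
  then have g': "\<And>x y. y \<in> set (k x) \<Longrightarrow> tsize (B (f x y)) \<le> g x" by simp
  note g = conjunct1[OF g] g'
  have "polytime E (enc_list B) (\<lambda>x. rev (fold (\<lambda>y acc. f x y # acc) (k x) []))"
  proof (rule polytime_rev, rule polytime_fold_additive[OF k])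
    show "pbound (\<lambda>x. tsize (E x)) (\<lambda>x. Suc (g x))" by (intro pbound_intros g)
    show "polytime (E \<otimes> A \<otimes> enc_list B) (enc_list B) (\<lambda>p. f (fst p) (fst (snd p)) # snd (snd p))"
      by (rule polytime_weaken[OF f] polytime_basic)+
  qed (use g in \<open>auto intro: polytime_const\<close>)
  moreover have eq: "fold (\<lambda>y acc. f x y # acc) ys acc = rev (map (f x) ys) @ acc" for x ys acc
    by (induction ys arbitrary: acc) auto
  ultimately show ?thesis by (simp only: eq append_Nil append_Nil2 rev_rev_ident simp_thms)
qed

lemma polytime_filter:
  assumes k: "polytime E (enc_list A) k" and P: "polytime (E \<otimes> A) tree_of_bool (\<lambda>p. P (fst p) (snd p))"
  shows "polytime E (enc_list A) (\<lambda>x. filter (P x) (k x))"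
proof -
  obtain g where g: "pbound (\<lambda>x. tsize (E x)) g \<and> (\<forall>x. \<forall>y \<in> set (k x). tsize (A y) \<le> g x)"
    using pbound_elem[OF k, where f = "\<lambda>_ y. y", OF polytime_snd'] ..
  then have g': "\<And>x y. y \<in> set (k x) \<Longrightarrow> tsize (A y) \<le> g x" by simp
  note g = conjunct1[OF g] g'
  have "polytime E (enc_list A) (\<lambda>x. rev (fold (\<lambda>y acc. if P x y then y # acc else acc) (k x) []))"
  proof (rule polytime_rev, rule polytime_fold_additive[OF k])
    show "pbound (\<lambda>x. tsize (E x)) (\<lambda>x. Suc (g x))" by (intro pbound_intros g)
    show "polytime (E \<otimes> A \<otimes> enc_list A) (enc_list A)
        (\<lambda>p. if P (fst p) (fst (snd p)) then fst (snd p) # snd (snd p) else snd (snd p))"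
      by (rule polytime_weaken[OF P] polytime_basic)+
  qed (use g in \<open>auto intro: polytime_const\<close>)
  moreover have eq: "fold (\<lambda>y acc. if P x y then y # acc else acc) ys acc = rev (filter (P x) ys) @ acc"
    for x ys acc
    by (induction ys arbitrary: acc) auto
  ultimately show ?thesis by (simp only: eq append_Nil append_Nil2 rev_rev_ident simp_thms)
qed

lemma polytime_Bex:
  assumes k: "polytime E (enc_list A) k" and P: "polytime (E \<otimes> A) tree_of_bool (\<lambda>p. P (fst p) (snd p))"
  shows "polytime E tree_of_bool (\<lambda>x. \<exists>y\<in>set (k x). P x y)"
proof -
  have "polytime E tree_of_bool (\<lambda>x. fold (\<lambda>y acc. acc \<or> P x y) (k x) False)"
  proof (rule polytime_fold_additive[OF k polytime_const _ pbound_const[of _ 3]])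
    show "tsize (tree_of_bool (acc \<or> P x y)) \<le> tsize (tree_of_bool acc) + 3" for x y acc
      using tsize_tree_of_bool_le[of "acc \<or> P x y"] by linarith
    show "polytime (E \<otimes> A \<otimes> tree_of_bool) tree_of_bool (\<lambda>p. snd (snd p) \<or> P (fst p) (fst (snd p)))"
      by (rule polytime_weaken[OF P] polytime_basic)+
  qed
  moreover have eq: "fold (\<lambda>y acc. acc \<or> P x y) ys acc \<longleftrightarrow> acc \<or> (\<exists>y\<in>set ys. P x y)" for x ys acc
    by (induction ys arbitrary: acc) auto
  ultimately show ?thesis by (simp only: eq append_Nil append_Nil2 rev_rev_ident simp_thms)
qed

lemma polytime_Ball:
  assumes k: "polytime E (enc_list A) k" and P: "polytime (E \<otimes> A) tree_of_bool (\<lambda>p. P (fst p) (snd p))"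
  shows "polytime E tree_of_bool (\<lambda>x. \<forall>y\<in>set (k x). P x y)"
proof -
  have "polytime E tree_of_bool (\<lambda>x. \<not> (\<exists>y\<in>set (k x). \<not> P x y))"
    by (rule polytime_not[OF polytime_Bex[OF k polytime_not[OF P]]])
  then show ?thesis by simp
qed

lemma polytime_member:
  assumes "polytime E A f" "polytime E (enc_list A) k" "inj A"
  shows "polytime E tree_of_bool (\<lambda>x. f x \<in> set (k x))"
proof -
  have "polytime E tree_of_bool (\<lambda>x. \<exists>y\<in>set (k x). y = f x)"
    by (rule polytime_Bex[OF assms(2) polytime_eq[OF polytime_snd'
            polytime_compose[OF polytime_fst' assms(1)] assms(3)]])
  then show ?thesis by simp
qed

lemma tsize_append: "tsize (enc_list A (xs @ ys)) < tsize (enc_list A xs) + tsize (enc_list A ys)"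
  by (induction xs) auto

lemma polytime_append:
  assumes "polytime E (enc_list A) f" "polytime E (enc_list A) g"
  shows "polytime E (enc_list A) (\<lambda>x. f x @ g x)"
proof -
  obtain b where b: "pbound (\<lambda>x. tsize (E x)) b \<and> (\<forall>x. \<forall>y \<in> set (rev (f x)). tsize (A y) \<le> b x)"
    using pbound_elem[OF polytime_rev[OF assms(1)], where f = "\<lambda>_ y. y", OF polytime_snd'] ..
  then have b': "\<And>x y. y \<in> set (rev (f x)) \<Longrightarrow> tsize (A y) \<le> b x" by simp
  note b = conjunct1[OF b] b'
  have "polytime E (enc_list A) (\<lambda>x. fold Cons (rev (f x)) (g x))"
  proof (rule polytime_fold_additive[OF polytime_rev])
    show "pbound (\<lambda>x. tsize (E x)) (\<lambda>x. Suc (b x))" by (intro pbound_intros b)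
    show "tsize (enc_list A (y # acc)) \<le> tsize (enc_list A acc) + Suc (b x)"
      if "y \<in> set (rev (f x))" for x y acc
      using b(2)[OF that] by simp
  qed (rule assms polytime_basic)+
  then show ?thesis by (simp add: fold_Cons_rev)
qed

lemma polytime_concat:
  assumes "polytime E (enc_list (enc_list A)) k"
  shows "polytime E (enc_list A) (\<lambda>x. concat (k x))"
proof -
  obtain b where b: "pbound (\<lambda>x. tsize (E x)) b \<and> (\<forall>x. \<forall>y \<in> set (k x). tsize (enc_list A y) \<le> b x)"
    using pbound_elem[OF assms, where f = "\<lambda>_ y. y", OF polytime_snd'] ..
  then have b': "\<And>x y. y \<in> set (k x) \<Longrightarrow> tsize (enc_list A y) \<le> b x" by simp
  note b = conjunct1[OF b] b'
  have "polytime E (enc_list A) (\<lambda>x. fold (\<lambda>xs acc. acc @ xs) (k x) [])"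
  proof (rule polytime_fold_additive[OF assms polytime_const _ b(1)])
    show "tsize (enc_list A (acc @ xs)) \<le> tsize (enc_list A acc) + b x" if "xs \<in> set (k x)" for x xs acc
      using tsize_append[of A acc xs] b(2)[OF that] by linarith
    show "polytime (E \<otimes> enc_list A \<otimes> enc_list A) (enc_list A) (\<lambda>p. snd (snd p) @ fst (snd p))"
      by (rule polytime_append polytime_basic)+
  qed
  moreover have eq: "fold (\<lambda>xs acc. acc @ xs) xss acc = acc @ concat xss" for acc :: "'b list" and xss
    by (induction xss arbitrary: acc) auto
  ultimately show ?thesis by (simp only: eq append_Nil append_Nil2 rev_rev_ident simp_thms)
qed

lemma polytime_imp:
  assumes "polytime E tree_of_bool b" "polytime E tree_of_bool c"
  shows "polytime E tree_of_bool (\<lambda>x. b x \<longrightarrow> c x)"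
proof -
  have "polytime E tree_of_bool (\<lambda>x. if b x then c x else True)"
    by (intro polytime_if polytime_const assms)
  then show ?thesis by (rule back_subst[of "polytime E tree_of_bool"]) auto
qed

lemma inj_enc_nat: "inj enc_nat"
  by (rule injI) (rule enc_nat_inj)

lemma inj_enc_list: "inj A \<Longrightarrow> inj (enc_list A)"
  by (rule injI) (auto intro: enc_list_inj dest: injD)

lemmas polytime_rules = polytime_basic polytime_imp polytime_map polytime_filter polytime_Bex
  polytime_Ball polytime_member polytime_rev polytime_append polytime_concat
  inj_enc_nat inj_enc_list inj_enc_prod

lemma polytime_dedup:
  assumes k: "polytime E (enc_list A) k" and A: "inj A"
  shows "polytime E (enc_list A) (\<lambda>x. fold List.insert (k x) [])"
proof -
  obtain g where g: "pbound (\<lambda>x. tsize (E x)) g \<and> (\<forall>x. \<forall>y\<in>set (k x). tsize (A y) \<le> g x)"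
    using pbound_elem[OF k, where f = "\<lambda>_ y. y", OF polytime_snd'] ..
  show ?thesis
  proof (rule polytime_fold_additive[OF k polytime_const])
    show "pbound (\<lambda>x. tsize (E x)) (\<lambda>x. Suc (g x))" by (intro pbound_intros conjunct1[OF g])
    show "tsize (enc_list A (List.insert y acc)) \<le> tsize (enc_list A acc) + Suc (g x)"
      if "y \<in> set (k x)" for x y acc
      using g that by (simp add: List.insert_def)
    show "polytime (E \<otimes> A \<otimes> enc_list A) (enc_list A) (\<lambda>p. List.insert (fst (snd p)) (snd (snd p)))"
      unfolding List.insert_def by (rule polytime_rules A)+
  qed
qed

text \<open>Written as a fold, and not by recursion, so that \<open>polytime_fold_additive\<close>
  applies; once the accumulator holds a success it no longer changes.\<close>

definition first_some :: "('a \<Rightarrow> 'b option) \<Rightarrow> 'a list \<Rightarrow> 'b option" where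
  "first_some f ys = fold (\<lambda>y acc. case acc of None \<Rightarrow> f y | Some z \<Rightarrow> Some z) ys None"

lemma polytime_first_some:
  assumes k: "polytime E (enc_list A) k"
    and f: "polytime (E \<otimes> A) (enc_option B) (\<lambda>p. f (fst p) (snd p))"
  shows "polytime E (enc_option B) (\<lambda>x. first_some (f x) (k x))"
proof -
  obtain g where g: "pbound (\<lambda>x. tsize (E x)) g \<and>
      (\<forall>x. \<forall>y\<in>set (k x). tsize (enc_option B (f x y)) \<le> g x)"
    using pbound_elem[OF k f] ..
  show ?thesis unfolding first_some_def
  proof (rule polytime_fold_additive[OF k polytime_const _ conjunct1[OF g]])
    show "tsize (enc_option B (case acc of None \<Rightarrow> f x y | Some z \<Rightarrow> Some z)) \<le>
        tsize (enc_option B acc) + g x" if "y \<in> set (k x)" for x y acc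
    proof -
      have "tsize (enc_option B (f x y)) \<le> g x" using g that by simp
      then show ?thesis by (auto split: option.split)
    qed
    show "polytime (E \<otimes> A \<otimes> enc_option B) (enc_option B)
        (\<lambda>p. case snd (snd p) of None \<Rightarrow> f (fst p) (fst (snd p)) | Some z \<Rightarrow> Some z)"
      by (rule polytime_weaken[OF f] polytime_basic)+
  qed
qed

text \<open>The results appear in reverse order.\<close>

definition traverse :: "('a \<Rightarrow> 'b option) \<Rightarrow> 'a list \<Rightarrow> 'b list option" where
  "traverse f ys = fold (\<lambda>y acc. case acc of None \<Rightarrow> None
     | Some zs \<Rightarrow> (case f y of None \<Rightarrow> None | Some z \<Rightarrow> Some (z # zs))) ys (Some [])"

lemma polytime_traverse:
  assumes k: "polytime E (enc_list A) k"
    and f: "polytime (E \<otimes> A) (enc_option B) (\<lambda>p. f (fst p) (snd p))"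
  shows "polytime E (enc_option (enc_list B)) (\<lambda>x. traverse (f x) (k x))"
proof -
  obtain g where g: "pbound (\<lambda>x. tsize (E x)) g \<and>
      (\<forall>x. \<forall>y\<in>set (k x). tsize (enc_option B (f x y)) \<le> g x)"
    using pbound_elem[OF k f] ..
  show ?thesis unfolding traverse_def
  proof (rule polytime_fold_additive[OF k])
    show "pbound (\<lambda>x. tsize (E x)) (\<lambda>x. Suc (g x))" by (intro pbound_intros conjunct1[OF g])
    show "tsize (enc_option (enc_list B) (case acc of None \<Rightarrow> None
        | Some zs \<Rightarrow> (case f x y of None \<Rightarrow> None | Some z \<Rightarrow> Some (z # zs)))) \<le>
        tsize (enc_option (enc_list B) acc) + Suc (g x)" if "y \<in> set (k x)" for x y acc
    proof -
      have "tsize (enc_option B (f x y)) \<le> g x" using g that by simp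
      then show ?thesis by (auto split: option.split)
    qed
    show "polytime (E \<otimes> A \<otimes> enc_option (enc_list B)) (enc_option (enc_list B))
        (\<lambda>p. case snd (snd p) of None \<Rightarrow> None
          | Some zs \<Rightarrow> (case f (fst p) (fst (snd p)) of None \<Rightarrow> None | Some z \<Rightarrow> Some (z # zs)))"
      by (rule polytime_weaken[OF f] polytime_compose[OF polytime_fst' polytime_weaken[OF f]] polytime_basic)+
  qed (rule polytime_basic)+
qed

text \<open>The last of several entries for a key wins, which is harmless as the tables below give
  equal keys equal values. A missing key looks the same as an unsolved one.\<close>

definition lookup :: "('k \<times> 'v option) list \<Rightarrow> 'k \<Rightarrow> 'v option" where
  "lookup tab b = fold (\<lambda>e acc. if fst e = b then snd e else acc) tab None"

lemma polytime_lookup: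
  assumes k: "polytime E (enc_list (A \<otimes> enc_option B)) k" and b: "polytime E A b" and A: "inj A"
  shows "polytime E (enc_option B) (\<lambda>x. lookup (k x) (b x))"
proof -
  have "polytime (E \<otimes> A \<otimes> enc_option B) (enc_option B) (\<lambda>p. snd (snd p))"
    by (rule polytime_basic)+
  then obtain g where g: "pbound (\<lambda>x. tsize (E x)) g \<and>
      (\<forall>x. \<forall>y\<in>set (k x). tsize (enc_option B (snd y)) \<le> g x)"
    using pbound_elem[OF k, where f = "\<lambda>_ y. snd y"] by meson
  show ?thesis unfolding lookup_def
  proof (rule polytime_fold_additive[OF k polytime_const _ conjunct1[OF g]])
    show "tsize (enc_option B (if fst e = b x then snd e else acc)) \<le>
        tsize (enc_option B acc) + g x" if "e \<in> set (k x)" for x e acc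
      using g that by (auto intro: trans_le_add2)
    show "polytime (E \<otimes> (A \<otimes> enc_option B) \<otimes> enc_option B) (enc_option B)
        (\<lambda>p. if fst (fst (snd p)) = b (fst p) then snd (fst (snd p)) else snd (snd p))"
      by (rule polytime_compose[OF _ b] polytime_basic A)+
  qed
qed

section \<open>The algorithm\<close>

text \<open>The result is always a filtered copy of \<open>vs\<close>. This bounds its size
  independently of \<open>W\<close>, and it fixes one list for each set of vertices.\<close>

definition reach_step :: "'a list \<Rightarrow> 'a list list \<Rightarrow> 'a list \<Rightarrow> 'a list \<Rightarrow> 'a list" where
  "reach_step vs es X W = filter (\<lambda>u. u \<notin> set X \<and>
     (u \<in> set W \<or> (\<exists>e\<in>set es. u \<in> set e \<and> (\<exists>w\<in>set e. w \<in> set W)))) vs"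

text \<open>The number of iterations is the squared length of \<open>vs\<close>, a bound on the number of pairs of
  adjacent vertices.\<close>

definition comp_list :: "'a list \<Rightarrow> 'a list list \<Rightarrow> 'a list \<Rightarrow> 'a \<Rightarrow> 'a list" where
  "comp_list vs es X v = fold (\<lambda>_. reach_step vs es X) (concat (map (\<lambda>_. vs) vs)) [v]"

definition comps :: "'a list \<Rightarrow> 'a list list \<Rightarrow> 'a list \<Rightarrow> 'a list list" where
  "comps vs es X = fold List.insert (map (comp_list vs es X) (filter (\<lambda>v. v \<notin> set X) vs)) []"

definition blocks :: "'a list \<Rightarrow> 'a list list \<Rightarrow> 'a list list \<Rightarrow> ('a list \<times> 'a list) list" where
  "blocks vs es ss = concat (map (\<lambda>X. map (\<lambda>C. (X, C)) (comps vs es X)) ss)"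

type_synonym 'a table = "(('a list \<times> 'a list) \<times> 'a list rtree option) list"

text \<open>The guard is \<open>basis\<close> spelled out with quantifiers over lists, the form that
  \<open>polytime_rules\<close> can process.\<close>

definition extend ::
  "'a list \<Rightarrow> 'a list list \<Rightarrow> 'a table \<Rightarrow> 'a list \<Rightarrow> 'a list \<Rightarrow> 'a list \<Rightarrow> 'a list rtree option" where
  "extend vs es tab X C Y =
    (if (\<forall>y\<in>set Y. y \<in> set X \<or> y \<in> set C) \<and>
        (\<forall>e\<in>set es. (\<exists>v\<in>set e. v \<in> set C) \<longrightarrow> (\<forall>v\<in>set e. v \<in> set C \<or> v \<in> set Y)) \<and>
        (\<forall>D\<in>set (comps vs es Y). (\<exists>v\<in>set D. v \<in> set C) \<longrightarrow> (\<forall>v\<in>set D. v \<in> set C))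
     then case traverse (\<lambda>D. lookup tab (Y, D)) (filter (\<lambda>D. \<exists>v\<in>set D. v \<in> set C) (comps vs es Y)) of
            None \<Rightarrow> None | Some ts \<Rightarrow> Some (Node Y ts)
     else None)"

definition attempt ::
  "'a list \<Rightarrow> 'a list list \<Rightarrow> 'a list list \<Rightarrow> 'a table \<Rightarrow> 'a list \<times> 'a list \<Rightarrow> 'a list rtree option" where
  "attempt vs es ss tab b = first_some (\<lambda>Y. if \<exists>y\<in>set Y. y \<in> set (snd b)
     then extend vs es tab (fst b) (snd b) Y else None) ss"

definition next_table :: "'a list \<Rightarrow> 'a list list \<Rightarrow> 'a list list \<Rightarrow> 'a table \<Rightarrow> 'a table" where
  "next_table vs es ss tab = map (\<lambda>b. (b, attempt vs es ss tab b)) (blocks vs es ss)"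

definition table :: "'a list \<Rightarrow> 'a list list \<Rightarrow> 'a list list \<Rightarrow> 'a table" where
  "table vs es ss = fold (\<lambda>_. next_table vs es ss) vs []"

definition solve :: "'a list \<Rightarrow> 'a list list \<Rightarrow> 'a list list \<Rightarrow> 'a list rtree option" where
  "solve vs es ss = first_some (extend vs es (table vs es ss) [] vs) ss"

section \<open>Polynomial time for the parts of the algorithm\<close>

abbreviation "EV \<equiv> enc_list enc_nat"
abbreviation "EF \<equiv> enc_list EV"
abbreviation "ET \<equiv> enc_list ((EV \<otimes> EV) \<otimes> enc_option (enc_rtree EV))"

lemma tsize_filter_le: "tsize (enc_list A (filter P xs)) \<le> tsize (enc_list A xs)"
  by (induction xs) auto

lemma polytime_comp_list:
  assumes vs: "polytime E EV vs" and es: "polytime E EF es"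
    and X: "polytime E EV X" and v: "polytime E enc_nat v"
  shows "polytime E EV (\<lambda>x. comp_list (vs x) (es x) (X x) (v x))"
proof -
  \<comment> \<open>Under a bound variable the argument becomes a pair, and \<open>vs x\<close>
    turns into \<open>vs (fst p)\<close>. These instances of composition trace such terms back to
    the assumptions; the following proofs do the same.\<close>
  note vars = polytime_compose[OF _ vs] polytime_compose[OF _ es] polytime_compose[OF _ X]
  show ?thesis unfolding comp_list_def
  proof (rule polytime_fold_additive)
    show "pbound (\<lambda>x. tsize (E x)) (\<lambda>x. tsize (EV (vs x)))" by (rule polytime_size[OF vs])
    show "tsize (EV (reach_step (vs x) (es x) (X x) acc)) \<le> tsize (EV acc) + tsize (EV (vs x))" for x acc
      unfolding reach_step_def by (rule trans_le_add2[OF tsize_filter_le])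
    show "polytime (E \<otimes> enc_nat \<otimes> EV) EV
        (\<lambda>p. reach_step (vs (fst p)) (es (fst p)) (X (fst p)) (snd (snd p)))"
      unfolding reach_step_def by (rule vars polytime_rules)+
  qed (rule vars v polytime_rules)+
qed

lemma polytime_comps:
  assumes vs: "polytime E EV vs" and es: "polytime E EF es" and X: "polytime E EV X"
  shows "polytime E EF (\<lambda>x. comps (vs x) (es x) (X x))"
proof -
  note vars = polytime_compose[OF _ vs] polytime_compose[OF _ es] polytime_compose[OF _ X]
  show ?thesis unfolding comps_def
    by (rule vars polytime_comp_list polytime_dedup polytime_rules)+
qed

lemma polytime_blocks:
  assumes vs: "polytime E EV vs" and es: "polytime E EF es" and ss: "polytime E EF ss"
  shows "polytime E (enc_list (EV \<otimes> EV)) (\<lambda>x. blocks (vs x) (es x) (ss x))"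
proof -
  note vars = polytime_compose[OF _ vs] polytime_compose[OF _ es] polytime_compose[OF _ ss]
  show ?thesis unfolding blocks_def
    by (rule vars polytime_comps polytime_rules)+
qed

lemma polytime_extend:
  assumes vs: "polytime E EV vs" and es: "polytime E EF es" and tab: "polytime E ET tab"
    and X: "polytime E EV X" and C: "polytime E EV C" and Y: "polytime E EV Y"
  shows "polytime E (enc_option (enc_rtree EV)) (\<lambda>x. extend (vs x) (es x) (tab x) (X x) (C x) (Y x))"
proof -
  note vars = polytime_compose[OF _ vs] polytime_compose[OF _ es] polytime_compose[OF _ tab]
    polytime_compose[OF _ X] polytime_compose[OF _ C] polytime_compose[OF _ Y]
  show ?thesis unfolding extend_def
    by (rule vars polytime_comps polytime_traverse polytime_lookup polytime_rules)+
qed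

lemma polytime_attempt:
  assumes vs: "polytime E EV vs" and es: "polytime E EF es" and ss: "polytime E EF ss"
    and tab: "polytime E ET tab" and b: "polytime E (EV \<otimes> EV) b"
  shows "polytime E (enc_option (enc_rtree EV)) (\<lambda>x. attempt (vs x) (es x) (ss x) (tab x) (b x))"
proof -
  note vars = polytime_compose[OF _ vs] polytime_compose[OF _ es] polytime_compose[OF _ ss]
    polytime_compose[OF _ tab] polytime_compose[OF _ b]
  show ?thesis unfolding attempt_def
    by (rule vars polytime_first_some polytime_extend polytime_rules)+
qed

lemma polytime_next_table:
  assumes vs: "polytime E EV vs" and es: "polytime E EF es" and ss: "polytime E EF ss"
    and tab: "polytime E ET tab"
  shows "polytime E ET (\<lambda>x. next_table (vs x) (es x) (ss x) (tab x))"
proof -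
  note vars = polytime_compose[OF _ vs] polytime_compose[OF _ es] polytime_compose[OF _ ss]
    polytime_compose[OF _ tab]
  show ?thesis unfolding next_table_def
    by (rule vars polytime_blocks polytime_attempt polytime_rules)+
qed

section \<open>Components as reachability classes\<close>

text \<open>Both ends must be vertices, as in \<open>path_joined\<close>, because for arbitrary
  input lists an edge may stick out of \<open>verts H\<close>.\<close>

definition adj :: "'a hypergraph \<Rightarrow> 'a set \<Rightarrow> ('a \<times> 'a) set" where
  "adj H X = {(u, w). u \<in> verts H - X \<and> w \<in> verts H - X \<and> (\<exists>e\<in>edges H. u \<in> e \<and> w \<in> e)}"

definition cls :: "'a hypergraph \<Rightarrow> 'a set \<Rightarrow> 'a \<Rightarrow> 'a set" where
  "cls H X v = {w. (v, w) \<in> (adj H X)\<^sup>*}"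

lemma sym_adj: "sym (adj H X)"
  by (auto simp: adj_def sym_def)

lemma adj_antimono: "X \<subseteq> Y \<Longrightarrow> adj H Y \<subseteq> adj H X"
  by (auto simp: adj_def)

lemma cls_self: "v \<in> cls H X v"
  by (simp add: cls_def)

lemma cls_eq: "w \<in> cls H X v \<Longrightarrow> cls H X w = cls H X v"
  unfolding cls_def using sym_adj[of H X, THEN sym_rtrancl, THEN symD]
  by (auto intro: rtrancl_trans)

lemma cls_subset: "v \<in> verts H - X \<Longrightarrow> cls H X v \<subseteq> verts H - X"
proof
  fix w assume "v \<in> verts H - X" "w \<in> cls H X v"
  then have "(v, w) \<in> (adj H X)\<^sup>*" "v \<in> verts H - X" by (auto simp: cls_def)
  then show "w \<in> verts H - X" by (induction rule: rtrancl_induct) (auto simp: adj_def)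
qed

lemma path_joined_iff:
  assumes "v \<in> verts H - X"
  shows "path_joined H X v w \<longleftrightarrow> w \<in> cls H X v"
proof
  assume "path_joined H X v w"
  then obtain h x e where x: "x 0 = v" "x (h::nat) = w" "\<forall>j\<le>h. x j \<in> verts H"
    "\<forall>j<h. e j \<in> edges H \<and> {x j, x (Suc j)} \<subseteq> e j - X"
    unfolding path_joined_def by blast
  have "(v, x j) \<in> (adj H X)\<^sup>*" if "j \<le> h" for j
    using that
  proof (induction j)
    case (Suc j)
    then have "(x j, x (Suc j)) \<in> adj H X"
      using x(3)[rule_format, of j] x(3)[rule_format, of "Suc j"] x(4)[rule_format, of j]
      by (auto simp: adj_def)
    then show ?case using Suc by (meson Suc_leD rtrancl.rtrancl_into_rtrancl)
  qed (simp add: x)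
  then show "w \<in> cls H X v" using x(2) by (auto simp: cls_def)
next
  assume "w \<in> cls H X v"
  then have "(v, w) \<in> (adj H X)\<^sup>*" by (simp add: cls_def)
  then obtain n where "(v, w) \<in> adj H X ^^ n" by (auto dest: rtrancl_imp_relpow)
  then obtain x where x: "x 0 = v" "x n = w" "\<forall>i<n. (x i, x (Suc i)) \<in> adj H X"
    unfolding relpow_fun_conv by blast
  define e where "e i = (SOME e. e \<in> edges H \<and> x i \<in> e \<and> x (Suc i) \<in> e)" for i
  have e: "e i \<in> edges H \<and> {x i, x (Suc i)} \<subseteq> e i - X" if "i < n" for i
  proof -
    have "(x i, x (Suc i)) \<in> adj H X" using x(3) that by blast
    then have "\<exists>e. e \<in> edges H \<and> x i \<in> e \<and> x (Suc i) \<in> e" and X: "x i \<notin> X" "x (Suc i) \<notin> X"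
      by (auto simp: adj_def)
    from someI_ex[OF this(1)] X show ?thesis by (simp add: e_def)
  qed
  \<comment> \<open>\<open>x 0\<close> is a vertex by assumption, which also covers
    \<open>n = 0\<close>; every later \<open>x j\<close> is the end of an adjacent pair.\<close>
  have "x j \<in> verts H" if "j \<le> n" for j
    using that x assms by (cases j) (auto simp: adj_def)
  then have "\<forall>j\<le>n. x j \<in> verts H" by simp
  moreover have "\<forall>j<n. e j \<in> edges H \<and> {x j, x (Suc j)} \<subseteq> e j - X" using e by simp
  ultimately show "path_joined H X v w" unfolding path_joined_def using x(1,2)
    by (intro exI[of _ n] exI[of _ x] exI[of _ e] conjI)
qed

lemma component_subset: "component H X D \<Longrightarrow> D \<subseteq> verts H - X"
  by (simp add: component_def)

lemma component_nonempty: "component H X D \<Longrightarrow> D \<noteq> {}"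
  by (simp add: component_def)

text \<open>Reachability outside \<open>X\<close> is an equivalence relation on the vertices outside
  \<open>X\<close>, and a maximal connected set is one of its classes. Disjointness and existence of
  components follow at once.\<close>

lemma component_iff: "component H X W \<longleftrightarrow> (\<exists>v\<in>verts H - X. W = cls H X v)"
proof
  assume W: "component H X W"
  obtain v where v: "v \<in> W" using component_nonempty[OF W] by blast
  then have vX: "v \<in> verts H - X" using component_subset[OF W] by blast
  have conn: "C_connected H X (cls H X v)"
    unfolding C_connected_def
  proof (intro conjI ballI)
    show "cls H X v \<subseteq> verts H" using cls_subset[OF vX] by blast
    fix u w assume u: "u \<in> cls H X v" and "w \<in> cls H X v"
    then have "w \<in> cls H X u" using cls_eq[OF u] by simp
    moreover have "u \<in> verts H - X" using cls_subset[OF vX] u by blast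
    ultimately show "path_joined H X u w" by (simp add: path_joined_iff)
  qed
  have max: "W' = W" if "W \<subseteq> W'" "W' \<subseteq> verts H - X" "C_connected H X W'" for W'
    using W that unfolding component_def by simp
  have "W \<subseteq> cls H X v"
  proof
    fix w assume "w \<in> W"
    then have "path_joined H X v w" using W v by (simp add: component_def C_connected_def)
    then show "w \<in> cls H X v" by (simp add: path_joined_iff[OF vX])
  qed
  from max[OF this cls_subset[OF vX] conn] vX show "\<exists>v\<in>verts H - X. W = cls H X v" by auto
next
  assume "\<exists>v\<in>verts H - X. W = cls H X v"
  then obtain v where v: "v \<in> verts H - X" "W = cls H X v" by blast
  have sub: "W \<subseteq> verts H - X" using cls_subset[OF v(1)] v(2) by simp
  have "v \<in> W" using cls_self v(2) by simp
  show "component H X W"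
    unfolding component_def
  proof (intro conjI allI impI)
    show "W \<noteq> {}" "W \<subseteq> verts H - X" using sub \<open>v \<in> W\<close> by auto
    show "C_connected H X W" unfolding C_connected_def
    proof (intro conjI ballI)
      show "W \<subseteq> verts H" using sub by blast
      fix u w assume u: "u \<in> W" and "w \<in> W"
      then have "w \<in> cls H X u" using cls_eq[of u H X v] v(2) by simp
      moreover have "u \<in> verts H - X" using sub u by blast
      ultimately show "path_joined H X u w" by (simp add: path_joined_iff)
    qed
    fix W' assume W': "W \<subseteq> W' \<and> W' \<subseteq> verts H - X \<and> C_connected H X W'"
    have "W' \<subseteq> W"
    proof
      fix w assume "w \<in> W'"
      then have "path_joined H X v w" using W' \<open>v \<in> W\<close> by (auto simp: C_connected_def)
      then show "w \<in> W" by (simp add: path_joined_iff[OF v(1)] v(2))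
    qed
    then show "W' = W" using W' by blast
  qed
qed

lemma component_disjoint:
  assumes "component H X D" "component H X D'" "D \<inter> D' \<noteq> {}" shows "D = D'"
proof -
  obtain v v' where v: "D = cls H X v" "D' = cls H X v'"
    using assms(1,2) by (auto simp: component_iff)
  obtain w where "w \<in> cls H X v" "w \<in> cls H X v'" using assms(3) v by blast
  then show ?thesis using cls_eq[of w H X v] cls_eq[of w H X v'] v by simp
qed

lemma component_exists:
  assumes "v \<in> verts H - X" shows "\<exists>D. component H X D \<and> v \<in> D"
  using assms by (intro exI[of _ "cls H X v"]) (auto simp: component_iff cls_self)

section \<open>Decompositions by recursion on the tree\<close>

definition occ :: "'a \<Rightarrow> 'a set rtree \<Rightarrow> nat list set" where
  "occ v T = {u \<in> nodes T. v \<in> bag T u}"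

lemma Nil_in_nodes: "[] \<in> nodes T"
  by (simp add: nodes_def)

lemma Cons_in_nodes: "i # p \<in> nodes (Node b ts) \<longleftrightarrow> i < length ts \<and> p \<in> nodes (ts ! i)"
  by (simp add: nodes_def)

lemma bag_Nil: "bag T [] = label T"
  by (simp add: bag_def)

lemma bag_Cons: "bag (Node b ts) (i # p) = bag (ts ! i) p"
  by (simp add: bag_def)

lemma nodes_Node: "nodes (Node b ts) = insert [] (\<Union>i<length ts. Cons i ` nodes (ts ! i))"
proof (rule set_eqI)
  show "p \<in> nodes (Node b ts) \<longleftrightarrow> p \<in> insert [] (\<Union>i<length ts. Cons i ` nodes (ts ! i))" for p
    by (cases p) (auto simp: Cons_in_nodes Nil_in_nodes)
qed

text \<open>Candidacy and edge covering ask which bags occur, not where; with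
  \<open>set_rtree\<close> they need no node positions.\<close>

lemma bags_eq_set_rtree: "bag T ` nodes T = set_rtree T"
proof (induction T)
  case (Node b ts)
  have "bag (Node b ts) ` nodes (Node b ts) = insert b (\<Union>i<length ts. bag (ts ! i) ` nodes (ts ! i))"
    by (auto simp: nodes_Node image_UN image_image bag_Nil bag_Cons)
  also have "\<dots> = insert b (\<Union>i<length ts. set_rtree (ts ! i))" using Node by simp
  also have "\<dots> = insert b (\<Union>t\<in>set ts. set_rtree t)" by (auto simp: set_conv_nth)
  finally show ?case by simp
qed

lemma tree_verts_eq: "tree_verts T = \<Union>(set_rtree T)"
  by (simp add: tree_verts_def bags_eq_set_rtree[symmetric])

lemma tree_verts_Node: "tree_verts (Node b ts) = b \<union> (\<Union>t\<in>set ts. tree_verts t)"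
  by (auto simp: tree_verts_eq)

lemma occ_empty_iff: "occ v T = {} \<longleftrightarrow> v \<notin> tree_verts T"
  by (auto simp: occ_def tree_verts_def)

lemma Nil_in_occ: "[] \<in> occ v T \<longleftrightarrow> v \<in> label T"
  by (simp add: occ_def Nil_in_nodes bag_Nil)

lemma Cons_in_occ: "i # p \<in> occ v (Node b ts) \<longleftrightarrow> i < length ts \<and> p \<in> occ v (ts ! i)"
  by (auto simp: occ_def Cons_in_nodes bag_Cons)

text \<open>The highest nodes of the connected parts of \<open>N\<close>: \<open>butlast p\<close>
  is the parent of \<open>p\<close>.\<close>

definition tops :: "nat list set \<Rightarrow> nat list set" where
  "tops N = {p \<in> N. p = [] \<or> butlast p \<notin> N}"

text \<open>In a rooted tree every maximal connected set of nodes within \<open>N\<close> has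
  exactly one highest node. So connectedness becomes uniqueness of the top, a condition that, unlike
  one on walks, can be computed by recursion on the tree.\<close>

lemma connected_nodes_iff: "connected_nodes N \<longleftrightarrow> (\<forall>p\<in>tops N. \<forall>q\<in>tops N. p = q)"
proof
  let ?R = "{(a, b). a \<in> N \<and> b \<in> N \<and> (child_of a b \<or> child_of b a)}"
  assume N: "connected_nodes N"
  \<comment> \<open>A walk in \<open>N\<close> that starts at a top cannot leave the subtree below
    it, since it would have to pass through the parent of the top.\<close>
  have below: "\<exists>z. q = p @ z" if "p \<in> tops N" "q \<in> N" for p q
  proof -
    have "(p, q) \<in> ?R\<^sup>*" using N that by (auto simp: connected_nodes_def tops_def)
    then show ?thesis
    proof (induction rule: rtrancl_induct)
      case (step y z)
      then obtain w where y: "y = p @ w" by blast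
      show ?case
      proof (cases "child_of y z")
        case True
        then obtain i where i: "y = z @ [i]" by (auto simp: child_of_def)
        show ?thesis
        proof (cases w rule: rev_cases)
          case Nil
          then show ?thesis using i y step(2) that(1) by (auto simp: tops_def)
        next
          case (snoc w' j)
          then have "z = p @ w'" using i y by simp
          then show ?thesis ..
        qed
      next
        case False
        then show ?thesis using step(2) y by (auto simp: child_of_def)
      qed
    qed simp
  qed
  show "\<forall>p\<in>tops N. \<forall>q\<in>tops N. p = q"
  proof (intro ballI)
    fix p q assume pq: "p \<in> tops N" "q \<in> tops N"
    then have "p \<in> N" "q \<in> N" by (auto simp: tops_def)
    then obtain z z' where "q = p @ z" "p = q @ z'" using below pq by blast
    then show "p = q" by simp
  qed
next
  let ?R = "{(a, b). a \<in> N \<and> b \<in> N \<and> (child_of a b \<or> child_of b a)}"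
  assume tops: "\<forall>p\<in>tops N. \<forall>q\<in>tops N. p = q"
  \<comment> \<open>Move to the parent as long as it stays in \<open>N\<close>; where this stops is
    a top.\<close>
  have climb: "\<exists>p\<in>tops N. (q, p) \<in> ?R\<^sup>*" if "q \<in> N" for q
    using that
  proof (induction q rule: rev_induct)
    case Nil
    then show ?case by (auto simp: tops_def)
  next
    case (snoc i q)
    show ?case
    proof (cases "q \<in> N")
      case True
      then have "(q @ [i], q) \<in> ?R" using snoc by (auto simp: child_of_def)
      then show ?thesis using snoc.IH[OF True] converse_rtrancl_into_rtrancl[of _ q ?R] by blast
    next
      case False
      then show ?thesis using snoc by (auto simp: tops_def)
    qed
  qed
  have "sym ?R" by (auto simp: sym_def)
  then have sym: "(a, b) \<in> ?R\<^sup>* \<Longrightarrow> (b, a) \<in> ?R\<^sup>*" for a b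
    by (rule symD[OF sym_rtrancl])
  show "connected_nodes N" unfolding connected_nodes_def
  proof (intro ballI)
    fix p q assume "p \<in> N" "q \<in> N"
    obtain p' where p': "p' \<in> tops N" "(p, p') \<in> ?R\<^sup>*" using climb[OF \<open>p \<in> N\<close>] by blast
    obtain q' where q': "q' \<in> tops N" "(q, q') \<in> ?R\<^sup>*" using climb[OF \<open>q \<in> N\<close>] by blast
    have "p' = q'" using tops p'(1) q'(1) by blast
    then show "(p, q) \<in> ?R\<^sup>*" using rtrancl_trans[OF p'(2)] sym[OF q'(2)] by simp
  qed
qed

lemma tops_empty_iff: "tops N = {} \<longleftrightarrow> N = {}"
proof -
  have "tops N \<noteq> {}" if "p \<in> N" for p
    using that
  proof (induction p rule: rev_induct)
    case Nil
    then have "[] \<in> tops N" by (simp add: tops_def)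
    then show ?case by blast
  next
    case (snoc i p)
    show ?case
    proof (cases "p \<in> N")
      case True
      then show ?thesis by (rule snoc.IH)
    next
      case False
      then have "p @ [i] \<in> tops N" using snoc.prems by (simp add: tops_def)
      then show ?thesis by blast
    qed
  qed
  moreover have "tops {} = {}" by (simp add: tops_def)
  ultimately show ?thesis by blast
qed

text \<open>The parent of a node inside a child subtree is the same within that subtree and within
  the whole tree. Only the root of the child gains a parent, so it ceases to be a top exactly if
  \<open>v \<in> b\<close>.\<close>

lemma tops_occ_Node:
  "tops (occ v (Node b ts)) = (if v \<in> b then {[]} else {}) \<union>
     (\<Union>i<length ts. Cons i ` {p \<in> tops (occ v (ts ! i)). p = [] \<longrightarrow> v \<notin> b})"
proof (rule set_eqI)
  show "q \<in> tops (occ v (Node b ts)) \<longleftrightarrow> q \<in> (if v \<in> b then {[]} else {}) \<union>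
     (\<Union>i<length ts. Cons i ` {p \<in> tops (occ v (ts ! i)). p = [] \<longrightarrow> v \<notin> b})" for q
  proof (cases q)
    case Nil
    then show ?thesis by (auto simp: tops_def Nil_in_occ)
  next
    case (Cons i p)
    have "i # p \<in> tops (occ v (Node b ts)) \<longleftrightarrow>
        i < length ts \<and> p \<in> tops (occ v (ts ! i)) \<and> (p = [] \<longrightarrow> v \<notin> b)"
      by (cases p) (auto simp: tops_def Nil_in_occ Cons_in_occ)
    moreover have mem: "i # p \<in> (\<Union>i<n. Cons i ` A i) \<longleftrightarrow> i < n \<and> p \<in> A i" for n A by auto
    ultimately show ?thesis by (simp only: Cons Un_iff mem) simp
  qed
qed

lemma tops_occ_empty_iff: "tops (occ v T) = {} \<longleftrightarrow> v \<notin> tree_verts T"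
  by (simp add: tops_empty_iff occ_empty_iff)

text \<open>With \<open>v\<close> in the root bag the root is a top, and it is the only one if every
  child's tops are absorbed at the child's root. Without it the tops are those of the children, so
  \<open>v\<close> may occur below one child only. Positions are compared because \<open>ts\<close>
  may contain equal trees.\<close>

lemma connected_occ_Node:
  "connected_nodes (occ v (Node b ts)) \<longleftrightarrow>
     (\<forall>t\<in>set ts. connected_nodes (occ v t)) \<and>
     (v \<in> b \<longrightarrow> (\<forall>t\<in>set ts. v \<in> tree_verts t \<longrightarrow> v \<in> label t)) \<and>
     (v \<notin> b \<longrightarrow> (\<forall>i<length ts. \<forall>j<length ts.
        v \<in> tree_verts (ts ! i) \<longrightarrow> v \<in> tree_verts (ts ! j) \<longrightarrow> i = j))"
proof (cases "v \<in> b")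
  case True
  have top_Nil: "p = [] \<longleftrightarrow> v \<in> label t" if "p \<in> tops (occ v t)" "connected_nodes (occ v t)" for t p
  proof
    assume "v \<in> label t"
    then have "[] \<in> tops (occ v t)" by (simp add: tops_def Nil_in_occ)
    then show "p = []" using that by (auto simp: connected_nodes_iff)
  qed (use that in \<open>auto simp: tops_def Nil_in_occ\<close>)
  have "connected_nodes (occ v (Node b ts)) \<longleftrightarrow>
      (\<forall>i<length ts. \<forall>p\<in>tops (occ v (ts ! i)). p = [])"
    unfolding connected_nodes_iff tops_occ_Node using True by auto
  also have "\<dots> \<longleftrightarrow> (\<forall>t\<in>set ts. \<forall>p\<in>tops (occ v t). p = [])"
    by (simp add: all_set_conv_all_nth)
  also have "\<dots> \<longleftrightarrow> (\<forall>t\<in>set ts. connected_nodes (occ v t) \<and> (v \<in> tree_verts t \<longrightarrow> v \<in> label t))"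
  proof (rule ball_cong[OF refl])
    fix t
    show "(\<forall>p\<in>tops (occ v t). p = []) \<longleftrightarrow>
        connected_nodes (occ v t) \<and> (v \<in> tree_verts t \<longrightarrow> v \<in> label t)"
    proof
      assume N: "\<forall>p\<in>tops (occ v t). p = []"
      have "connected_nodes (occ v t)"
        unfolding connected_nodes_iff
      proof (intro ballI)
        fix p q assume pq: "p \<in> tops (occ v t)" "q \<in> tops (occ v t)"
        show "p = q" using bspec[OF N pq(1)] bspec[OF N pq(2)] by simp
      qed
      moreover have "v \<in> label t" if "v \<in> tree_verts t"
      proof -
        have "tops (occ v t) \<noteq> {}" using that by (simp add: tops_occ_empty_iff)
        then obtain p where p: "p \<in> tops (occ v t)" by blast
        have "[] \<in> occ v t" using bspec[OF N p] p by (simp add: tops_def)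
        then show ?thesis by (simp add: Nil_in_occ)
      qed
      ultimately show "connected_nodes (occ v t) \<and> (v \<in> tree_verts t \<longrightarrow> v \<in> label t)" by simp
    next
      assume N: "connected_nodes (occ v t) \<and> (v \<in> tree_verts t \<longrightarrow> v \<in> label t)"
      show "\<forall>p\<in>tops (occ v t). p = []"
      proof
        fix p assume p: "p \<in> tops (occ v t)"
        then have "tops (occ v t) \<noteq> {}" by blast
        then have "v \<in> label t" using N by (simp add: tops_occ_empty_iff)
        then show "p = []" using top_Nil[OF p] N by simp
      qed
    qed
  qed
  finally show ?thesis using True by auto
next
  case False
  have "connected_nodes (occ v (Node b ts)) \<longleftrightarrow>
      (\<forall>i<length ts. \<forall>j<length ts. \<forall>p\<in>tops (occ v (ts ! i)). \<forall>q\<in>tops (occ v (ts ! j)). i = j \<and> p = q)"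
    unfolding connected_nodes_iff tops_occ_Node using False by auto
  also have "\<dots> \<longleftrightarrow> (\<forall>i<length ts. connected_nodes (occ v (ts ! i))) \<and>
      (\<forall>i<length ts. \<forall>j<length ts. tops (occ v (ts ! i)) \<noteq> {} \<longrightarrow>
         tops (occ v (ts ! j)) \<noteq> {} \<longrightarrow> i = j)"
    unfolding connected_nodes_iff by blast
  finally show ?thesis using False by (simp add: all_set_conv_all_nth tops_occ_empty_iff)
qed

lemma component_normal_form_Node:
  "component_normal_form H (Node b ts) \<longleftrightarrow> (\<forall>t\<in>set ts. component_normal_form H t \<and>
     (\<exists>!C. component H b C \<and> tree_verts t = C \<union> (b \<inter> label t)))"
proof -
  define P where "P T r s \<longleftrightarrow> (\<exists>!C. component H (bag T r) C \<and>
    tree_verts (subtree T s) = C \<union> (bag T r \<inter> bag T s))" for T r s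
  have cnf: "component_normal_form H T \<longleftrightarrow> (\<forall>r i. r @ [i] \<in> nodes T \<longrightarrow> P T r (r @ [i]))" for T
  proof -
    have "r \<in> nodes T" if "r @ [i] \<in> nodes T" for r i
      using that unfolding nodes_def by (induction r arbitrary: T) auto
    then show ?thesis unfolding component_normal_form_def P_def child_of_def by blast
  qed
  have sub: "P (Node b ts) (i # r) (i # s) \<longleftrightarrow> P (ts ! i) r s" for i r s
    by (simp add: P_def bag_Cons)
  have top: "P (Node b ts) [] [i] \<longleftrightarrow>
      (\<exists>!C. component H b C \<and> tree_verts (ts ! i) = C \<union> (b \<inter> label (ts ! i)))" for i
    by (simp add: P_def bag_Cons bag_Nil)
  have "component_normal_form H (Node b ts) \<longleftrightarrow>
      (\<forall>i. [i] \<in> nodes (Node b ts) \<longrightarrow> P (Node b ts) [] [i]) \<and>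
      (\<forall>j r i. j # r @ [i] \<in> nodes (Node b ts) \<longrightarrow> P (Node b ts) (j # r) (j # r @ [i]))"
    (is "_ \<longleftrightarrow> ?A \<and> ?B")
  proof
    assume "component_normal_form H (Node b ts)"
    note * = this[unfolded cnf, rule_format]
    show "?A \<and> ?B" using *[of "[]"] *[of "_ # _"] by simp
  next
    assume *: "?A \<and> ?B"
    have "P (Node b ts) r (r @ [i])" if "r @ [i] \<in> nodes (Node b ts)" for r i
      using that * by (cases r) simp_all
    then show "component_normal_form H (Node b ts)" by (simp add: cnf)
  qed
  moreover have "?A \<longleftrightarrow> (\<forall>i<length ts. P (Node b ts) [] [i])"
    by (simp add: Cons_in_nodes Nil_in_nodes)
  moreover have "?B \<longleftrightarrow> (\<forall>j<length ts. component_normal_form H (ts ! j))"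
    unfolding cnf Cons_in_nodes sub by blast
  ultimately have "component_normal_form H (Node b ts) \<longleftrightarrow>
      (\<forall>i<length ts. P (Node b ts) [] [i]) \<and> (\<forall>j<length ts. component_normal_form H (ts ! j))"
    by (simp only:)
  then show ?thesis unfolding top all_set_conv_all_nth by blast
qed

section \<open>Block trees\<close>

text \<open>The interface of a subtree that hangs below a node with bag \<open>X\<close> and serves
  the component \<open>C\<close>: the equation for \<open>tree_verts T\<close> is the one in
  component normal form. Edges that miss \<open>C\<close> can be left to other parts of the
  decomposition.\<close>

definition block_tree :: "'a hypergraph \<Rightarrow> 'a set set \<Rightarrow> 'a set \<Rightarrow> 'a set \<Rightarrow> 'a set rtree \<Rightarrow> bool" where
  "block_tree H S X C T \<longleftrightarrow> set_rtree T \<subseteq> S \<and> (\<forall>v. connected_nodes (occ v T)) \<and>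
     component_normal_form H T \<and> tree_verts T = C \<union> (X \<inter> label T) \<and>
     (\<forall>e\<in>edges H. e \<inter> C \<noteq> {} \<longrightarrow> (\<exists>b\<in>set_rtree T. e \<subseteq> b))"

text \<open>The share of \<open>block_tree\<close> that concerns the root bag alone: necessary by
  \<open>block_tree_Node\<close>, and by \<open>block_tree_NodeI\<close> sufficient together with
  solutions for the components that remain.\<close>

definition basis :: "'a hypergraph \<Rightarrow> 'a set \<Rightarrow> 'a set \<Rightarrow> 'a set \<Rightarrow> bool" where
  "basis H X C Y \<longleftrightarrow> Y \<subseteq> X \<union> C \<and> (\<forall>e\<in>edges H. e \<inter> C \<noteq> {} \<longrightarrow> e \<subseteq> C \<union> Y) \<and>
     (\<forall>D. component H Y D \<longrightarrow> D \<inter> C \<noteq> {} \<longrightarrow> D \<subseteq> C)"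

text \<open>For empty \<open>X\<close> the vertex equation says that the bags cover exactly
  \<open>verts H\<close>: every vertex lies in an edge and every edge in a bag. As edges are
  non-empty, all of them meet \<open>verts H\<close>.\<close>

lemma candidate_cnf_iff_block_tree:
  assumes H: "hypergraph H" and S: "S \<subseteq> Pow (verts H)"
  shows "candidate_td H S T \<and> component_normal_form H T \<longleftrightarrow> block_tree H S {} (verts H) T"
proof -
  have edges: "e \<inter> verts H \<noteq> {}" if "e \<in> edges H" for e
    using H that by (auto simp: hypergraph_def)
  have verts: "verts H \<subseteq> tree_verts T" if "\<forall>e\<in>edges H. \<exists>b\<in>set_rtree T. e \<subseteq> b"
  proof
    fix v assume "v \<in> verts H"
    then obtain e where "e \<in> edges H" "v \<in> e" using H by (auto simp: hypergraph_def)
    moreover from this that obtain b where "b \<in> set_rtree T" "e \<subseteq> b" by blast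
    ultimately show "v \<in> tree_verts T" unfolding tree_verts_eq by blast
  qed
  \<comment> \<open>A vertex that occurs nowhere has no nodes to connect, so
    \<open>block_tree\<close> may quantify over all \<open>v\<close>.\<close>
  have occ: "connected_nodes (occ v T)" if "v \<notin> tree_verts T" for v
    using that occ_empty_iff[of v T] by (simp add: connected_nodes_def)
  have occ_verts: "(\<forall>v\<in>verts H. connected_nodes (occ v T)) \<longleftrightarrow> (\<forall>v. connected_nodes (occ v T))"
    if "tree_verts T \<subseteq> verts H"
    using that occ by blast
  have cand: "candidate_td H S T \<longleftrightarrow> tree_verts T \<subseteq> verts H \<and>
      (\<forall>e\<in>edges H. \<exists>b\<in>set_rtree T. e \<subseteq> b) \<and> (\<forall>v\<in>verts H. connected_nodes (occ v T)) \<and>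
      set_rtree T \<subseteq> S"
    unfolding candidate_td_def tree_decomposition_def tree_verts_def occ_def
      bags_eq_set_rtree[symmetric] by (simp add: UN_subset_iff image_subset_iff) 
  show ?thesis
  proof
    assume "candidate_td H S T \<and> component_normal_form H T"
    then show "block_tree H S {} (verts H) T"
      using verts occ_verts unfolding cand block_tree_def by simp
  next
    assume T: "block_tree H S {} (verts H) T"
    then have V: "tree_verts T = verts H" by (simp add: block_tree_def)
    have "\<exists>b\<in>set_rtree T. e \<subseteq> b" if "e \<in> edges H" for e
      using T edges[OF that] that by (simp add: block_tree_def)
    then show "candidate_td H S T \<and> component_normal_form H T"
      using T V unfolding cand by (simp add: block_tree_def)
  qed
qed

lemma block_tree_Node:
  assumes T: "block_tree H S X C (Node Y ts)"
  shows "basis H X C Y"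
    and "component H Y D \<Longrightarrow> D \<inter> C \<noteq> {} \<Longrightarrow> \<exists>t\<in>set ts. block_tree H S Y D t"
proof -
  have V: "Y \<union> (\<Union>t\<in>set ts. tree_verts t) = C \<union> (X \<inter> Y)"
    using T by (auto simp: block_tree_def tree_verts_Node)
  have cnf: "component_normal_form H t" "\<exists>D. component H Y D \<and> tree_verts t = D \<union> (Y \<inter> label t)"
    if "t \<in> set ts" for t
  proof -
    from T that have *: "component_normal_form H t \<and>
        (\<exists>!D. component H Y D \<and> tree_verts t = D \<union> (Y \<inter> label t))"
      by (simp add: block_tree_def component_normal_form_Node)
    show "component_normal_form H t" by (rule conjunct1[OF *])
    show "\<exists>D. component H Y D \<and> tree_verts t = D \<union> (Y \<inter> label t)"
      by (rule ex1_implies_ex[OF conjunct2[OF *]])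
  qed
  \<comment> \<open>A vertex of \<open>D \<inter> C\<close> is outside \<open>Y\<close>, so it must
    occur below some child; the component of that child meets \<open>D\<close> and hence equals
    \<open>D\<close>.\<close>
  have child: "\<exists>t\<in>set ts. tree_verts t = D \<union> (Y \<inter> label t)"
    if D: "component H Y D" "D \<inter> C \<noteq> {}" for D
  proof -
    obtain v where v: "v \<in> D" "v \<in> C" using D by blast
    then have "v \<notin> Y" using component_subset[OF D(1)] by blast
    then obtain t where t: "t \<in> set ts" "v \<in> tree_verts t" using v V by blast
    obtain D' where D': "component H Y D'" "tree_verts t = D' \<union> (Y \<inter> label t)"
      using cnf(2)[OF t(1)] by blast
    have "v \<in> D'" using t(2) \<open>v \<notin> Y\<close> unfolding D'(2) by simp
    then have "D' = D" using component_disjoint[OF D'(1) D(1)] v by blast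
    then show ?thesis using t(1) D'(2) by auto
  qed
  \<comment> \<open>\<open>D\<close> lies in the vertex set \<open>C \<union> (X \<inter> Y)\<close>
    of the tree and avoids \<open>Y\<close>.\<close>
  have D_sub: "D \<subseteq> C" if D: "component H Y D" "D \<inter> C \<noteq> {}" for D
  proof -
    obtain t where t: "t \<in> set ts" "tree_verts t = D \<union> (Y \<inter> label t)" using child[OF D] ..
    then have "D \<subseteq> C \<union> (X \<inter> Y)" unfolding V[symmetric] by blast
    then show ?thesis using component_subset[OF D(1)] by blast
  qed
  show "basis H X C Y"
    unfolding basis_def
  proof (intro conjI ballI allI impI)
    show "Y \<subseteq> X \<union> C" using V by blast
    show "e \<subseteq> C \<union> Y" if "e \<in> edges H" "e \<inter> C \<noteq> {}" for e
    proof -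
      have "\<exists>b\<in>set_rtree (Node Y ts). e \<subseteq> b" using T that by (simp add: block_tree_def)
      then have "e \<subseteq> tree_verts (Node Y ts)" unfolding tree_verts_eq by blast
      then show ?thesis unfolding tree_verts_Node V by blast
    qed
  qed (use D_sub in blast)
  show "\<exists>t\<in>set ts. block_tree H S Y D t" if D: "component H Y D" "D \<inter> C \<noteq> {}"
  proof -
    obtain t where t: "t \<in> set ts" "tree_verts t = D \<union> (Y \<inter> label t)" using child[OF D] by blast
    \<comment> \<open>Some bag of the whole tree covers \<open>e\<close>. It contains a vertex
      \<open>w \<in> D\<close> outside \<open>Y\<close>, so it is not the root bag; and by
      connectedness \<open>w\<close> occurs below one child only, namely \<open>t\<close>.\<close>
    have edge: "\<exists>b\<in>set_rtree t. e \<subseteq> b" if e: "e \<in> edges H" "e \<inter> D \<noteq> {}" for e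
    proof -
      obtain w where w: "w \<in> e" "w \<in> D" using e by blast
      then have wY: "w \<notin> Y" using component_subset[OF D(1)] by blast
      have "e \<inter> C \<noteq> {}" using w D_sub[OF D] by blast
      then have "\<exists>b\<in>set_rtree (Node Y ts). e \<subseteq> b" using T e(1) by (simp add: block_tree_def)
      then obtain b where b: "b \<in> set_rtree (Node Y ts)" "e \<subseteq> b" by blast
      then have "b \<noteq> Y" using w wY by blast
      then obtain t' where t': "t' \<in> set ts" "b \<in> set_rtree t'" using b(1) by auto
      then have wt': "w \<in> tree_verts t'" using b(2) w(1) by (auto simp: tree_verts_eq)
      obtain i j where ij: "i < length ts" "ts ! i = t" "j < length ts" "ts ! j = t'"
        using t(1) t'(1) by (meson in_set_conv_nth)
      have "connected_nodes (occ w (Node Y ts))" using T by (simp add: block_tree_def)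
      then have "\<forall>i<length ts. \<forall>j<length ts.
          w \<in> tree_verts (ts ! i) \<longrightarrow> w \<in> tree_verts (ts ! j) \<longrightarrow> i = j"
        using wY by (simp add: connected_occ_Node)
      moreover have "w \<in> tree_verts t" using t(2) w(2) by simp
      ultimately have "i = j" using wt' ij by blast
      then show ?thesis using ij t' b by blast
    qed
    have "block_tree H S Y D t"
      unfolding block_tree_def
    proof (intro conjI allI ballI impI)
      show "set_rtree t \<subseteq> S" using T t(1) by (auto simp: block_tree_def)
      show "connected_nodes (occ v t)" for v
        using T t(1) by (simp add: block_tree_def connected_occ_Node)
    qed (use cnf(1) t edge in simp_all)
    then show ?thesis using t by blast
  qed
qed

text \<open>\<open>f\<close> maps an index to the component it stands for; in the algorithm the
  indices are lists and \<open>f\<close> is \<open>set\<close>. Distinctness and injectivity keep a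
  component from getting two children, which would disconnect its vertices.\<close>

lemma block_tree_NodeI:
  assumes b: "basis H X C Y" and Y: "Y \<in> S" and C: "C \<subseteq> verts H"
    and Ds: "distinct Ds" "inj_on f (set Ds)" "f ` set Ds = {D. component H Y D \<and> D \<inter> C \<noteq> {}}"
    and g: "\<And>d. d \<in> set Ds \<Longrightarrow> block_tree H S Y (f d) (g d)"
  shows "block_tree H S X C (Node Y (map g Ds))"
proof -
  have f: "component H Y (f d)" "f d \<inter> C \<noteq> {}" "f d \<subseteq> C" "f d \<inter> Y = {}" if "d \<in> set Ds" for d
  proof -
    from that Ds(3) show 1: "component H Y (f d)" "f d \<inter> C \<noteq> {}" by auto
    then show "f d \<subseteq> C" "f d \<inter> Y = {}" using b component_subset[OF 1(1)] by (auto simp: basis_def)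
  qed
  have gV: "tree_verts (g d) = f d \<union> (Y \<inter> label (g d))" if "d \<in> set Ds" for d
    using g[OF that] by (simp add: block_tree_def)
  \<comment> \<open>The component of \<open>Y\<close> around such a vertex meets \<open>C\<close>
    and is therefore listed. Both the vertex equation and the covering of edges rest on
    this.\<close>
  have cover: "\<exists>d\<in>set Ds. v \<in> f d" if v: "v \<in> C - Y" for v
  proof -
    have "v \<in> verts H - Y" using v C by blast
    then obtain D where "component H Y D" "v \<in> D" using component_exists[of v H Y] by blast
    then have "D \<in> f ` set Ds" unfolding Ds(3) using v by blast
    then show ?thesis using \<open>v \<in> D\<close> by blast
  qed
  show ?thesis
    unfolding block_tree_def
  proof (intro conjI allI ballI impI)
    show "set_rtree (Node Y (map g Ds)) \<subseteq> S"
    proof -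
      have "set_rtree (g d) \<subseteq> S" if "d \<in> set Ds" for d
        using g[OF that] by (simp add: block_tree_def)
      then show ?thesis using Y by auto
    qed
    show "connected_nodes (occ v (Node Y (map g Ds)))" for v
      unfolding connected_occ_Node
    proof (intro conjI ballI impI allI)
      fix t assume t: "t \<in> set (map g Ds)"
      then obtain d where d: "d \<in> set Ds" "t = g d" by auto
      show "connected_nodes (occ v t)" using g[OF d(1)] d(2) by (simp add: block_tree_def)
      show "v \<in> label t" if "v \<in> Y" "v \<in> tree_verts t"
        using that f(4)[OF d(1)] unfolding d(2) gV[OF d(1)] by blast
    next
      fix i j assume v: "v \<notin> Y" and ij: "i < length (map g Ds)" "j < length (map g Ds)"
        and "v \<in> tree_verts (map g Ds ! i)" "v \<in> tree_verts (map g Ds ! j)"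
      then have "v \<in> f (Ds ! i)" "v \<in> f (Ds ! j)" using gV[of "Ds ! i"] gV[of "Ds ! j"] by auto
      then have "f (Ds ! i) = f (Ds ! j)"
        using ij f(1)[of "Ds ! i"] f(1)[of "Ds ! j"] by (intro component_disjoint[of H Y]) auto
      then have "Ds ! i = Ds ! j" using Ds(2) ij by (auto dest: inj_onD)
      then show "i = j" using Ds(1) ij by (simp add: nth_eq_iff_index_eq)
    qed
    show "component_normal_form H (Node Y (map g Ds))"
      unfolding component_normal_form_Node
    proof (intro ballI conjI)
      fix t assume "t \<in> set (map g Ds)"
      then obtain d where d: "d \<in> set Ds" "t = g d" by auto
      show "component_normal_form H t" using g[OF d(1)] d(2) by (simp add: block_tree_def)
      show "\<exists>!D. component H Y D \<and> tree_verts t = D \<union> (Y \<inter> label t)"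
      proof (rule ex1I[of _ "f d"])
        show "component H Y (f d) \<and> tree_verts t = f d \<union> (Y \<inter> label t)"
          using f(1)[OF d(1)] gV[OF d(1)] d(2) by simp
        \<comment> \<open>Both sets avoid \<open>Y\<close>, so each of them is
          \<open>tree_verts t - Y\<close>.\<close>
        show "D = f d" if "component H Y D \<and> tree_verts t = D \<union> (Y \<inter> label t)" for D
        proof -
          have "D \<inter> Y = {}" using that component_subset[of H Y D] by blast
          moreover have "D \<union> (Y \<inter> label t) = f d \<union> (Y \<inter> label t)"
            using that gV[OF d(1)] d(2) by simp
          ultimately show ?thesis using f(4)[OF d(1)] by blast
        qed
      qed
    qed
    have "tree_verts (Node Y (map g Ds)) = Y \<union> (\<Union>d\<in>set Ds. f d)"
      using gV by (auto simp: tree_verts_Node)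
    also have "\<dots> = Y \<union> C" using cover f(3) by blast
    also have "\<dots> = C \<union> (X \<inter> Y)" using b by (auto simp: basis_def)
    finally show "tree_verts (Node Y (map g Ds)) = C \<union> (X \<inter> label (Node Y (map g Ds)))" by simp
    show "\<exists>B\<in>set_rtree (Node Y (map g Ds)). e \<subseteq> B" if e: "e \<in> edges H" "e \<inter> C \<noteq> {}" for e
    \<comment> \<open>An edge inside \<open>Y\<close> is covered by the root bag. Any other one that
      meets \<open>C\<close> has a vertex in \<open>C - Y\<close>, hence meets some listed
      component, whose subtree covers it.\<close>
    proof (cases "e \<subseteq> Y")
      case False
      have "e \<subseteq> C \<union> Y" using b e by (auto simp: basis_def)
      then obtain w where "w \<in> e" "w \<in> C - Y" using False by blast
      then obtain d where d: "d \<in> set Ds" "e \<inter> f d \<noteq> {}" using cover by blast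
      then show ?thesis using g[OF d(1)] e(1) by (auto simp: block_tree_def)
    qed simp
  qed
qed

text \<open>The least fixed point that the rounds of the table approximate, stated without trees;
  its induction rule drives the completeness proof.\<close>

inductive solvable :: "'a hypergraph \<Rightarrow> 'a set set \<Rightarrow> 'a set \<Rightarrow> 'a set \<Rightarrow> bool" for H S where
  "Y \<in> S \<Longrightarrow> Y \<inter> C \<noteq> {} \<Longrightarrow> basis H X C Y \<Longrightarrow>
   (\<And>D. component H Y D \<Longrightarrow> D \<inter> C \<noteq> {} \<Longrightarrow> solvable H S Y D) \<Longrightarrow> solvable H S X C"

text \<open>A root bag \<open>Y\<close> that misses \<open>C\<close> can be skipped: \<open>C\<close> is then a component of \<open>Y\<close> too, and the
  bag of the corresponding child is a basis for \<open>(X, C)\<close> as well.\<close>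

lemma block_tree_solvable:
  "block_tree H S X C T \<Longrightarrow> component H X C \<Longrightarrow> solvable H S X C"
proof (induction T arbitrary: X C)
  case (Node Y ts)
  note b = block_tree_Node[OF Node.prems(1)]
  have IH: "solvable H S Y D" if "component H Y D" "D \<inter> C \<noteq> {}" for D
    using b(2)[OF that] Node.IH that(1) by blast
  show ?case
  proof (cases "Y \<inter> C = {}")
    case False
    have "Y \<in> S" using Node.prems(1) by (simp add: block_tree_def)
    then show ?thesis using False b(1) IH by (rule solvable.intros)
  next
    case True
    have YX: "Y \<subseteq> X" using b(1) True by (auto simp: basis_def)
    obtain v where v: "v \<in> verts H - X" "C = cls H X v"
      using Node.prems(2) by (auto simp: component_iff)
    \<comment> \<open>As \<open>Y \<subseteq> X\<close>, removing only \<open>Y\<close> can only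
      enlarge the class of \<open>v\<close>. The converse inclusion comes from \<open>basis\<close>,
      since the class meets \<open>C\<close> in \<open>v\<close>.\<close>
    have "C \<subseteq> cls H Y v"
      using rtrancl_mono[OF adj_antimono[OF YX]] v(2) by (auto simp: cls_def)
    moreover have D: "component H Y (cls H Y v)" using v(1) YX by (auto simp: component_iff)
    moreover have "v \<in> cls H Y v" "v \<in> C" using cls_self v(2) by auto
    ultimately have C: "cls H Y v = C" using b(1) unfolding basis_def by blast
    then have "solvable H S Y C" using IH D \<open>v \<in> C\<close> by auto
    then show ?thesis
    proof cases
      case (1 Z)
      \<comment> \<open>Of the bag above, \<open>basis\<close> asks only that \<open>Z\<close> stays
        within it and \<open>C\<close>, so it passes from \<open>Y\<close> to the larger
        \<open>X\<close>.\<close>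
      have "basis H X C Z" using 1(3) YX by (auto simp: basis_def)
      then show ?thesis using 1(4) by (rule solvable.intros[OF 1(1,2)])
    qed
  qed
qed

section \<open>Correctness\<close>

definition hg :: "'a list \<Rightarrow> 'a list list \<Rightarrow> 'a hypergraph" where
  "hg vs es = \<lparr> verts = set vs, edges = set (map set es) \<rparr>"

lemma hg_simps [simp]: "verts (hg vs es) = set vs" "edges (hg vs es) = set ` set es"
  by (simp_all add: hg_def)

section \<open>Components computed by iterated reachability\<close>

lemma fold_const: "fold (\<lambda>_. f) xs a = (f ^^ length xs) a"
  by (induction xs arbitrary: a) (simp_all add: funpow_swap1)

lemma set_reach_step:
  assumes "set W \<subseteq> set vs - set X"
  shows "set (reach_step vs es X W) = set W \<union> adj (hg vs es) (set X) `` set W"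
proof (rule set_eqI)
  fix u
  have "u \<in> adj (hg vs es) (set X) `` set W \<longleftrightarrow>
      u \<in> set vs - set X \<and> (\<exists>e\<in>set es. u \<in> set e \<and> (\<exists>w\<in>set e. w \<in> set W))"
    using assms by (auto simp: adj_def Image_def)
  then show "u \<in> set (reach_step vs es X W) \<longleftrightarrow> u \<in> set W \<union> adj (hg vs es) (set X) `` set W"
    using assms by (auto simp: reach_step_def)
qed

lemma set_reach_step_iterate:
  assumes v: "v \<in> set vs - set X"
  shows "set ((reach_step vs es X ^^ k) [v]) = (\<Union>j\<le>k. (adj (hg vs es) (set X) ^^ j) `` {v})"
proof (induction k)
  case (Suc k)
  let ?R = "adj (hg vs es) (set X)" and ?W = "(reach_step vs es X ^^ k) [v]"
  have "(v, u) \<in> ?R ^^ j \<Longrightarrow> u \<in> set vs - set X" for j u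
    using cls_subset[of v "hg vs es" "set X"] v relpow_imp_rtrancl[of "(v, u)" j ?R]
    by (auto simp: cls_def)
  then have "set ?W \<subseteq> set vs - set X" unfolding Suc.IH by blast
  then have "set ((reach_step vs es X ^^ Suc k) [v]) = set ?W \<union> ?R `` set ?W"
    by (simp add: set_reach_step)
  also have "\<dots> = (\<Union>j\<le>Suc k. (?R ^^ j) `` {v})"
  proof
    show "set ?W \<union> ?R `` set ?W \<subseteq> (\<Union>j\<le>Suc k. (?R ^^ j) `` {v})"
      unfolding Suc.IH
    proof (intro Un_least subsetI)
      fix u assume "u \<in> ?R `` (\<Union>j\<le>k. (?R ^^ j) `` {v})"
      then obtain j w where "j \<le> k" "(v, w) \<in> ?R ^^ j" "(w, u) \<in> ?R" by blast
      then have "(v, u) \<in> ?R ^^ Suc j" "Suc j \<le> Suc k" by auto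
      then show "u \<in> (\<Union>j\<le>Suc k. (?R ^^ j) `` {v})" by blast
    qed (auto intro: le_SucI)
    show "(\<Union>j\<le>Suc k. (?R ^^ j) `` {v}) \<subseteq> set ?W \<union> ?R `` set ?W"
    proof
      fix u assume "u \<in> (\<Union>j\<le>Suc k. (?R ^^ j) `` {v})"
      then obtain j where j: "j \<le> Suc k" "(v, u) \<in> ?R ^^ j" by blast
      show "u \<in> set ?W \<union> ?R `` set ?W"
      proof (cases "j = Suc k")
        case True
        then obtain w where w: "(v, w) \<in> ?R ^^ k" "(w, u) \<in> ?R" using j(2) by auto
        then have "w \<in> set ?W" unfolding Suc.IH by blast
        then show ?thesis using w(2) by blast
      next
        case False
        then have "j \<le> k" using j(1) by simp
        then show ?thesis unfolding Suc.IH using j(2) by blast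
      qed
    qed
  qed
  finally show ?case .
qed simp

lemma set_comp_list:
  assumes v: "v \<in> set vs - set X"
  shows "set (comp_list vs es X v) = cls (hg vs es) (set X) v"
proof -
  let ?R = "adj (hg vs es) (set X)" and ?n = "length vs * length vs"
  have sub: "?R \<subseteq> set vs \<times> set vs" by (auto simp: adj_def)
  then have fin: "finite ?R" by (rule finite_subset) simp
  have "card ?R \<le> card (set vs \<times> set vs)" by (rule card_mono[OF _ sub]) simp
  also have "\<dots> \<le> ?n" by (simp add: card_cartesian_product mult_le_mono card_length)
  finally have card: "card ?R \<le> ?n" .
  have "set (comp_list vs es X v) = (\<Union>j\<le>?n. (?R ^^ j) `` {v})"
    unfolding comp_list_def fold_const
    by (simp add: set_reach_step_iterate[OF v] length_concat comp_def sum_list_triv)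
  also have "\<dots> = ?R\<^sup>* `` {v}"
  proof
    show "(\<Union>j\<le>?n. (?R ^^ j) `` {v}) \<subseteq> ?R\<^sup>* `` {v}" by (auto intro: relpow_imp_rtrancl)
    show "?R\<^sup>* `` {v} \<subseteq> (\<Union>j\<le>?n. (?R ^^ j) `` {v})"
    proof
      \<comment> \<open>In a finite relation every reachable point is reached in at most as many
        steps as the relation has pairs, and \<open>?n\<close> bounds that number.\<close>
      fix u assume "u \<in> ?R\<^sup>* `` {v}"
      then have "(v, u) \<in> (\<Union>n\<in>{n. n \<le> card ?R}. ?R ^^ n)"
        using rtrancl_finite_eq_relpow[OF fin] by simp
      then obtain j where "j \<le> card ?R" "(v, u) \<in> ?R ^^ j" by blast
      moreover from this(1) card have "j \<le> ?n" by linarith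
      ultimately show "u \<in> (\<Union>j\<le>?n. (?R ^^ j) `` {v})" by blast
    qed
  qed
  finally show ?thesis by (auto simp: cls_def)
qed

text \<open>The last iteration filters \<open>vs\<close>, so the list depends only on the set it
  represents, not on the starting vertex. A component thus has a single list, which makes equality
  of lists a valid test for table keys.\<close>

lemma comp_list_eq_filter:
  assumes v: "v \<in> set vs - set X"
  shows "comp_list vs es X v = filter (\<lambda>u. u \<in> cls (hg vs es) (set X) v) vs"
proof -
  have "\<exists>W. comp_list vs es X v = reach_step vs es X W"
  proof (cases "concat (map (\<lambda>_. vs) vs)" rule: rev_cases)
    \<comment> \<open>At least one iteration takes place because \<open>vs\<close> contains
      \<open>v\<close>; without any, the result would be \<open>[v]\<close>.\<close>
    case Nil
    then show ?thesis using v by auto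
  next
    case (snoc ys y)
    then show ?thesis unfolding comp_list_def by auto
  qed
  then obtain W where W: "comp_list vs es X v = reach_step vs es X W" ..
  have "reach_step vs es X W = filter (\<lambda>u. u \<in> set (reach_step vs es X W)) vs"
    unfolding reach_step_def by (intro filter_cong) auto
  then show ?thesis unfolding W[symmetric] set_comp_list[OF v] .
qed

lemma set_fold_insert: "set (fold List.insert xs ys) = set xs \<union> set ys"
  by (induction xs arbitrary: ys) auto

lemma distinct_fold_insert: "distinct ys \<Longrightarrow> distinct (fold List.insert xs ys)"
  by (induction xs arbitrary: ys) auto

lemma distinct_comps: "distinct (comps vs es X)"
  by (simp add: comps_def distinct_fold_insert)

lemma set_comps: "set (comps vs es X) = comp_list vs es X ` (set vs - set X)"
  by (auto simp: comps_def set_fold_insert)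

lemma components_eq_comps: "set ` set (comps vs es X) = {D. component (hg vs es) (set X) D}"
proof -
  have "set ` set (comps vs es X) = cls (hg vs es) (set X) ` (set vs - set X)"
    unfolding set_comps image_image by (rule image_cong[OF refl]) (simp add: set_comp_list)
  then show ?thesis by (auto simp: component_iff)
qed

lemma component_comps: "D \<in> set (comps vs es X) \<Longrightarrow> component (hg vs es) (set X) (set D)"
  using components_eq_comps[of vs es X] by blast

text \<open>Different lists among the components stand for different sets, so removing equal lists
  leaves one list, and later one child, per component.\<close>

lemma inj_on_set_comps: "inj_on set (set (comps vs es X))"
proof (rule inj_onI)
  fix C D assume "C \<in> set (comps vs es X)" "D \<in> set (comps vs es X)" and eq: "set C = set D"
  then obtain v w where v: "v \<in> set vs - set X" "C = comp_list vs es X v"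
    and w: "w \<in> set vs - set X" "D = comp_list vs es X w"
    unfolding set_comps by blast
  have "cls (hg vs es) (set X) v = cls (hg vs es) (set X) w"
    using eq set_comp_list[OF v(1)] set_comp_list[OF w(1)] v(2) w(2) by simp
  then show "C = D" using comp_list_eq_filter[OF v(1)] comp_list_eq_filter[OF w(1)] v(2) w(2) by simp
qed

section \<open>Meaning of search, traversal and lookup\<close>

lemma first_some_eq_None: "first_some f ys = None \<longleftrightarrow> (\<forall>y\<in>set ys. f y = None)"
proof -
  have "fold (\<lambda>y acc. case acc of None \<Rightarrow> f y | Some z \<Rightarrow> Some z) ys a = None \<longleftrightarrow>
      a = None \<and> (\<forall>y\<in>set ys. f y = None)" for a
    by (induction ys arbitrary: a) (auto split: option.splits)
  then show ?thesis by (simp add: first_some_def)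
qed

lemma first_some_eq_SomeD:
  assumes "first_some f ys = Some z" shows "\<exists>y\<in>set ys. f y = Some z"
proof -
  have "a = Some z \<or> (\<exists>y\<in>set ys. f y = Some z)"
    if "fold (\<lambda>y acc. case acc of None \<Rightarrow> f y | Some z \<Rightarrow> Some z) ys a = Some z" for a
    using that by (induction ys arbitrary: a) (fastforce split: option.splits)+
  from this[of None] assms show ?thesis by (simp add: first_some_def)
qed

lemma traverse_eq:
  "traverse f ys = (if \<forall>y\<in>set ys. f y \<noteq> None then Some (map (\<lambda>y. the (f y)) (rev ys)) else None)"
proof -
  let ?h = "\<lambda>y acc. case acc of None \<Rightarrow> None
     | Some zs \<Rightarrow> (case f y of None \<Rightarrow> None | Some z \<Rightarrow> Some (z # zs))"
  have None: "fold ?h ys None = None" for ys by (induction ys) auto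
  have "fold ?h ys (Some zs) =
      (if \<forall>y\<in>set ys. f y \<noteq> None then Some (map (\<lambda>y. the (f y)) (rev ys) @ zs) else None)" for zs
    by (induction ys arbitrary: zs) (auto simp: None split: option.split)
  then show ?thesis by (simp add: traverse_def)
qed

lemma lookup_Nil: "lookup [] b = None"
  by (simp add: lookup_def)

lemma lookup_map: "lookup (map (\<lambda>b. (b, g b)) bs) b = (if b \<in> set bs then g b else None)"
proof -
  have "fold (\<lambda>e acc. if fst e = b then snd e else acc) (map (\<lambda>b. (b, g b)) bs) a =
      (if b \<in> set bs then g b else a)" for a
    by (induction bs arbitrary: a) auto
  then show ?thesis by (simp add: lookup_def)
qed

lemma extend_eq_Some:
  fixes vs es tab Y C
  defines "Ds \<equiv> filter (\<lambda>D. \<exists>v\<in>set D. v \<in> set C) (comps vs es Y)"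
  shows "extend vs es tab X C Y = Some t \<longleftrightarrow> basis (hg vs es) (set X) (set C) (set Y) \<and>
    (\<forall>D\<in>set Ds. lookup tab (Y, D) \<noteq> None) \<and> t = Node Y (map (\<lambda>D. the (lookup tab (Y, D))) (rev Ds))"
proof -
  have "(\<forall>y\<in>set Y. y \<in> set X \<or> y \<in> set C) \<longleftrightarrow> set Y \<subseteq> set X \<union> set C" by blast
  moreover have "(\<forall>e\<in>set es. (\<exists>v\<in>set e. v \<in> set C) \<longrightarrow> (\<forall>v\<in>set e. v \<in> set C \<or> v \<in> set Y)) \<longleftrightarrow>
      (\<forall>e\<in>edges (hg vs es). e \<inter> set C \<noteq> {} \<longrightarrow> e \<subseteq> set C \<union> set Y)"
    by (simp add: disjoint_iff subset_iff) blast
  moreover have "(\<forall>D\<in>set (comps vs es Y). (\<exists>v\<in>set D. v \<in> set C) \<longrightarrow> (\<forall>v\<in>set D. v \<in> set C)) \<longleftrightarrow>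
      (\<forall>D\<in>set ` set (comps vs es Y). D \<inter> set C \<noteq> {} \<longrightarrow> D \<subseteq> set C)"
    by (simp add: disjoint_iff subset_iff) blast
  ultimately have basis: "((\<forall>y\<in>set Y. y \<in> set X \<or> y \<in> set C) \<and>
        (\<forall>e\<in>set es. (\<exists>v\<in>set e. v \<in> set C) \<longrightarrow> (\<forall>v\<in>set e. v \<in> set C \<or> v \<in> set Y)) \<and>
        (\<forall>D\<in>set (comps vs es Y). (\<exists>v\<in>set D. v \<in> set C) \<longrightarrow> (\<forall>v\<in>set D. v \<in> set C))) \<longleftrightarrow>
      basis (hg vs es) (set X) (set C) (set Y)"
    unfolding basis_def components_eq_comps by simp
  show ?thesis unfolding extend_def basis Ds_def traverse_eq by auto
qed

section \<open>Soundness and completeness of the table\<close>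

lemma mem_blocks: "(X, C) \<in> set (blocks vs es ss) \<longleftrightarrow> X \<in> set ss \<and> C \<in> set (comps vs es X)"
  by (auto simp: blocks_def)

lemma lookup_next_table:
  "lookup (next_table vs es ss tab) b =
     (if b \<in> set (blocks vs es ss) then attempt vs es ss tab b else None)"
  by (simp add: next_table_def lookup_map)

text \<open>Soundness asks of the table only that its entries for \<open>Y\<close> are right, and of
  \<open>C\<close> only that it consists of vertices; so it serves both a round of the table and the
  root, where \<open>C\<close> need not be a component.\<close>

lemma extend_block_tree:
  assumes t: "extend vs es tab X C Y = Some t" and Y: "Y \<in> set ss" and C: "set C \<subseteq> set vs"
    and tab: "\<And>D u. lookup tab (Y, D) = Some u \<Longrightarrow>
      block_tree (hg vs es) (set ` set ss) (set Y) (set D) (map_rtree set u)"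
  shows "block_tree (hg vs es) (set ` set ss) (set X) (set C) (map_rtree set t)"
proof -
  define Ds where "Ds = filter (\<lambda>D. \<exists>v\<in>set D. v \<in> set C) (comps vs es Y)"
  let ?g = "\<lambda>D. map_rtree set (the (lookup tab (Y, D)))"
  from t have t': "basis (hg vs es) (set X) (set C) (set Y)" "\<forall>D\<in>set Ds. lookup tab (Y, D) \<noteq> None"
    "t = Node Y (map (\<lambda>D. the (lookup tab (Y, D))) (rev Ds))"
    unfolding extend_eq_Some Ds_def by auto
  have "block_tree (hg vs es) (set ` set ss) (set X) (set C) (Node (set Y) (map ?g (rev Ds)))"
  proof (rule block_tree_NodeI[OF t'(1)])
    show "set Y \<in> set ` set ss" using Y by simp
    show "set C \<subseteq> verts (hg vs es)" using C by simp
    show "distinct (rev Ds)" by (simp add: Ds_def distinct_comps)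
    show "inj_on set (set (rev Ds))"
      by (rule inj_on_subset[OF inj_on_set_comps[of vs es Y]]) (auto simp: Ds_def)
    have "set ` set (rev Ds) = {D \<in> set ` set (comps vs es Y). D \<inter> set C \<noteq> {}}"
      by (auto simp: Ds_def)
    then show "set ` set (rev Ds) = {D. component (hg vs es) (set Y) D \<and> D \<inter> set C \<noteq> {}}"
      by (simp add: components_eq_comps)
    show "block_tree (hg vs es) (set ` set ss) (set Y) (set D) (?g D)" if "D \<in> set (rev Ds)" for D
    proof (rule tab)
      have "lookup tab (Y, D) \<noteq> None" using t'(2) that by simp
      then show "lookup tab (Y, D) = Some (the (lookup tab (Y, D)))" by simp
    qed
  qed
  moreover have "map_rtree set t = Node (set Y) (map ?g (rev Ds))" by (simp add: t'(3))
  ultimately show ?thesis by simp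
qed

lemma lookup_block_tree:
  "lookup ((next_table vs es ss ^^ k) []) (X, C) = Some t \<Longrightarrow>
   block_tree (hg vs es) (set ` set ss) (set X) (set C) (map_rtree set t)"
proof (induction k arbitrary: X C t)
  case 0
  then show ?case by (simp add: lookup_Nil)
next
  case (Suc k)
  let ?tab = "(next_table vs es ss ^^ k) []"
  have b: "(X, C) \<in> set (blocks vs es ss)" and "attempt vs es ss ?tab (X, C) = Some t"
    using Suc.prems by (auto simp: lookup_next_table split: if_splits)
  then obtain Y where Y: "Y \<in> set ss" "extend vs es ?tab X C Y = Some t"
    unfolding attempt_def by (auto dest!: first_some_eq_SomeD split: if_splits)
  have "C \<in> set (comps vs es X)" using b by (simp add: mem_blocks)
  then have "set C \<subseteq> set vs" using component_subset[OF component_comps] by fastforce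
  from extend_block_tree[OF Y(2,1) this Suc.IH] show ?case .
qed

text \<open>A solution of \<open>(X, C)\<close> rests on blocks with strictly smaller components.
  Hence a block is solved after as many rounds as its component has vertices, and it remains solved
  in all later rounds.\<close>

lemma solvable_lookup:
  assumes "solvable (hg vs es) (set ` set ss) X' C'"
  shows "X' = set X \<Longrightarrow> C' = set C \<Longrightarrow> X \<in> set ss \<Longrightarrow> C \<in> set (comps vs es X) \<Longrightarrow>
    card (set C) \<le> k \<Longrightarrow> lookup ((next_table vs es ss ^^ k) []) (X, C) \<noteq> None"
  using assms
proof (induction arbitrary: X C k rule: solvable.induct)
  case (1 Y' C' X')
  \<comment> \<open>Components are non-empty, so \<open>k\<close> is positive and there is a last
    round to look into.\<close>
  have "set C \<noteq> {}" using component_nonempty[OF component_comps[OF 1(9)]] .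
  then obtain j where k: "k = Suc j" using 1(10) by (cases k) auto
  let ?tab = "(next_table vs es ss ^^ j) []"
  obtain Y where Y: "Y \<in> set ss" "Y' = set Y" using 1(1) by auto
  have b: "basis (hg vs es) (set X) (set C) (set Y)" using 1(3,6,7) Y(2) by simp
  have "lookup ?tab (Y, D) \<noteq> None" if D: "D \<in> set (comps vs es Y)" "\<exists>v\<in>set D. v \<in> set C" for D
  proof (rule 1(5)[OF _ _ Y(2) refl Y(1) D(1)])
    show comp: "component (hg vs es) Y' (set D)" using component_comps[OF D(1)] Y(2) by simp
    show meets: "set D \<inter> C' \<noteq> {}" using D(2) 1(7) by auto
    have "set D \<subseteq> set C" using b comp meets 1(7) Y(2) by (simp add: basis_def)
    moreover have "set D \<inter> set Y = {}" using component_subset[OF comp] Y(2) by auto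
    \<comment> \<open>\<open>D\<close> avoids \<open>Y\<close> while \<open>C\<close> meets it, so
      the inclusion is proper.\<close>
    ultimately have "set D \<subset> set C" using 1(2,7) Y(2) by auto
    then have "card (set D) < card (set C)" by (simp add: psubset_card_mono)
    then show "card (set D) \<le> j" using 1(10) k by simp
  qed
  then have "extend vs es ?tab X C Y \<noteq> None"
    using b by (simp add: extend_eq_Some not_None_eq del: split_paired_Ex)
  moreover have "\<exists>y\<in>set Y. y \<in> set C" using 1(2,7) Y(2) by auto
  ultimately have "attempt vs es ss ?tab (X, C) \<noteq> None"
    unfolding attempt_def first_some_eq_None using Y(1) by auto
  then show ?case using 1(8,9) by (simp add: k lookup_next_table mem_blocks)
qed

theorem solve_correct:
  assumes H: "hypergraph (hg vs es)" and S: "set ` set ss \<subseteq> Pow (set vs)"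
  defines "sol \<equiv> \<lambda>T. candidate_td (hg vs es) (set ` set ss) T \<and> component_normal_form (hg vs es) T"
  shows "solve vs es ss = Some t \<Longrightarrow> sol (map_rtree set t)"
    and "solve vs es ss = None \<Longrightarrow> \<not> sol T"
proof -
  have sol: "sol T \<longleftrightarrow> block_tree (hg vs es) (set ` set ss) {} (set vs) T" for T
    using candidate_cnf_iff_block_tree[OF H, of "set ` set ss" T] S by (simp add: sol_def)
  have tab: "table vs es ss = (next_table vs es ss ^^ length vs) []"
    by (simp add: table_def fold_const)
  show "sol (map_rtree set t)" if t: "solve vs es ss = Some t"
  proof -
    obtain Y where Y: "Y \<in> set ss" "extend vs es (table vs es ss) [] vs Y = Some t"
      using first_some_eq_SomeD[OF t[unfolded solve_def]] by blast
    have "block_tree (hg vs es) (set ` set ss) (set []) (set vs) (map_rtree set t)"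
      by (rule extend_block_tree[OF Y(2,1) order_refl]) (simp only: tab lookup_block_tree)
    then show ?thesis by (simp add: sol)
  qed
  show "\<not> sol T" if None: "solve vs es ss = None"
  proof
    assume "sol T"
    obtain Y' ts where "T = Node Y' ts" by (cases T)
    then have T: "block_tree (hg vs es) (set ` set ss) {} (set vs) (Node Y' ts)"
      using \<open>sol T\<close> sol by simp
    then have "Y' \<in> set ` set ss" by (simp add: block_tree_def)
    then obtain Y where Y: "Y \<in> set ss" "Y' = set Y" by auto
    have b: "basis (hg vs es) (set []) (set vs) (set Y)" using block_tree_Node(1)[OF T] Y(2) by simp
    \<comment> \<open>Solvability is used only below the root: \<open>set D\<close> is a component
      of \<open>set Y\<close>, as \<open>block_tree_solvable\<close> demands, whereas
      \<open>set vs\<close> need not be a component of the empty set. The root bag is tested by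
      \<open>extend\<close> directly.\<close>
    have "lookup (table vs es ss) (Y, D) \<noteq> None"
      if D: "D \<in> set (comps vs es Y)" "\<exists>v\<in>set D. v \<in> set vs" for D
    proof -
      have comp: "component (hg vs es) (set Y) (set D)" by (rule component_comps[OF D(1)])
      have "set D \<inter> set vs \<noteq> {}" using D(2) by auto
      then obtain t where "block_tree (hg vs es) (set ` set ss) (set Y) (set D) t"
        using block_tree_Node(2)[OF T, of "set D"] comp Y(2) by auto
      then have "solvable (hg vs es) (set ` set ss) (set Y) (set D)"
        using comp by (rule block_tree_solvable)
      moreover have "card (set D) \<le> length vs"
      proof -
        have "set D \<subseteq> set vs" using component_subset[OF comp] by auto
        then have "card (set D) \<le> card (set vs)" by (simp add: card_mono)
        also have "\<dots> \<le> length vs" by (rule card_length)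
        finally show ?thesis .
      qed
      ultimately show ?thesis unfolding tab
        by (rule solvable_lookup[OF _ refl refl Y(1) D(1)])
    qed
    then have "extend vs es (table vs es ss) [] vs Y \<noteq> None"
      using b by (simp add: extend_eq_Some)
    moreover have "extend vs es (table vs es ss) [] vs Y = None"
      using None Y(1) unfolding solve_def first_some_eq_None by blast
    ultimately show False by simp
  qed
qed

section \<open>Running time\<close>

lemma tsize_enc_rtree_Node:
  "tsize (enc_rtree A (Node b ts)) = Suc (tsize (A b) + tsize (enc_list (enc_rtree A) ts))"
  by (simp only: enc_rtree_Node tsize.simps)

text \<open>Distinct components of \<open>Y\<close> are disjoint and avoid \<open>Y\<close>, so
  vertices of \<open>C - Y\<close> can pay for all children together.\<close>

lemma sum_card_comps:
  assumes Ds: "set Ds \<subseteq> set (comps vs es Y)" "distinct Ds"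
    and sub: "\<And>D. D \<in> set Ds \<Longrightarrow> set D \<subseteq> set C"
  shows "(\<Sum>D\<leftarrow>Ds. card (set D)) \<le> card (set C - set Y)"
proof -
  have comp: "component (hg vs es) (set Y) (set D)" if "D \<in> set Ds" for D
    using component_comps Ds(1) that by blast
  have "(\<Sum>D\<leftarrow>Ds. card (set D)) = (\<Sum>D\<in>set Ds. card (set D))"
    by (rule sum_list_distinct_conv_sum_set[OF Ds(2)])
  also have "\<dots> = card (\<Union>D\<in>set Ds. set D)"
  proof (rule card_UN_disjoint[symmetric])
    show "\<forall>D\<in>set Ds. \<forall>D'\<in>set Ds. D \<noteq> D' \<longrightarrow> set D \<inter> set D' = {}"
    proof (intro ballI impI)
      fix D D' assume D: "D \<in> set Ds" "D' \<in> set Ds" "D \<noteq> D'"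
      then have "set D \<noteq> set D'"
        using inj_onD[OF inj_on_set_comps, of D D' vs es Y] Ds(1) by blast
      then show "set D \<inter> set D' = {}" using component_disjoint[OF comp[OF D(1)] comp[OF D(2)]] by blast
    qed
  qed simp_all
  also have "\<dots> \<le> card (set C - set Y)"
  proof (rule card_mono)
    show "(\<Union>D\<in>set Ds. set D) \<subseteq> set C - set Y"
    proof
      fix v assume "v \<in> (\<Union>D\<in>set Ds. set D)"
      then obtain D where D: "D \<in> set Ds" "v \<in> set D" by blast
      then show "v \<in> set C - set Y" using component_subset[OF comp[OF D(1)]] sub[OF D(1)] by auto
    qed
  qed simp
  finally show ?thesis .
qed

text \<open>A tree for a block \<open>(X, C)\<close> has at most \<open>card C\<close> nodes, because the root bag meets \<open>C\<close> and
  the blocks of the children are disjoint subsets of \<open>C\<close> minus the root bag.\<close>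

lemma tsize_extend:
  assumes t: "extend vs es tab X C Y = Some t" and K: "tsize (EV Y) \<le> K"
    and tab: "\<And>D u. lookup tab (Y, D) = Some u \<Longrightarrow>
      Suc (tsize (enc_rtree EV u)) \<le> card (set D) * (K + 3)"
  shows "Suc (tsize (enc_rtree EV t)) \<le> Suc (card (set C - set Y)) * (K + 3)"
proof -
  define Ds where "Ds = rev (filter (\<lambda>D. \<exists>v\<in>set D. v \<in> set C) (comps vs es Y))"
  from t have b: "basis (hg vs es) (set X) (set C) (set Y)"
    and some: "\<forall>D\<in>set Ds. lookup tab (Y, D) \<noteq> None"
    and t_eq: "t = Node Y (map (\<lambda>D. the (lookup tab (Y, D))) Ds)"
    unfolding extend_eq_Some Ds_def by auto
  have "Suc (tsize (enc_rtree EV (the (lookup tab (Y, D))))) \<le> card (set D) * (K + 3)"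
    if "D \<in> set Ds" for D
  proof (rule tab)
    have "lookup tab (Y, D) \<noteq> None" using some that by simp
    then show "lookup tab (Y, D) = Some (the (lookup tab (Y, D)))" by simp
  qed
  then have "(\<Sum>D\<leftarrow>Ds. Suc (tsize (enc_rtree EV (the (lookup tab (Y, D)))))) \<le>
      (\<Sum>D\<leftarrow>Ds. card (set D) * (K + 3))"
    by (rule sum_list_mono)
  also have "\<dots> = (\<Sum>D\<leftarrow>Ds. card (set D)) * (K + 3)"
    by (rule sum_list_mult_const)
  also have "\<dots> \<le> card (set C - set Y) * (K + 3)"
  proof (rule mult_le_mono1, rule sum_card_comps[of _ vs es])
    show "set Ds \<subseteq> set (comps vs es Y)" "distinct Ds" by (auto simp: Ds_def distinct_comps)
    show "set D \<subseteq> set C" if "D \<in> set Ds" for D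
    proof -
      have "D \<in> set (comps vs es Y)" "set D \<inter> set C \<noteq> {}" using that by (auto simp: Ds_def)
      then show ?thesis using b component_comps[of D vs es Y] by (simp add: basis_def)
    qed
  qed
  \<comment> \<open>The node itself costs at most \<open>K + 3\<close>: \<open>K\<close> for its
    bag, one each for its \<open>Branch\<close> and the end of its list of children, and one for the
    outer \<open>Suc\<close>, which stands for its cell in the list of its parent.\<close>
  finally show ?thesis using K
    unfolding t_eq tsize_enc_rtree_Node tsize_enc_list by (simp add: comp_def)
qed

lemma tsize_lookup:
  assumes K: "\<And>Y. Y \<in> set ss \<Longrightarrow> tsize (EV Y) \<le> K"
  shows "lookup ((next_table vs es ss ^^ k) []) (X, C) = Some t \<Longrightarrow>
    Suc (tsize (enc_rtree EV t)) \<le> card (set C) * (K + 3)"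
proof (induction k arbitrary: X C t)
  case 0
  then show ?case by (simp add: lookup_Nil)
next
  case (Suc k)
  let ?tab = "(next_table vs es ss ^^ k) []"
  have "attempt vs es ss ?tab (X, C) = Some t"
    using Suc.prems by (auto simp: lookup_next_table split: if_splits)
  then obtain Y where Y: "Y \<in> set ss" "extend vs es ?tab X C Y = Some t" "\<exists>y\<in>set Y. y \<in> set C"
    unfolding attempt_def by (auto dest!: first_some_eq_SomeD split: if_splits)
  have "Suc (tsize (enc_rtree EV t)) \<le> Suc (card (set C - set Y)) * (K + 3)"
    by (rule tsize_extend[OF Y(2) K[OF Y(1)] Suc.IH])
  \<comment> \<open>A vertex in both \<open>Y\<close> and \<open>C\<close> pays for the
    root.\<close>
  also have "Suc (card (set C - set Y)) \<le> card (set C)"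
    using Y(3) by (intro Suc_leI psubset_card_mono) auto
  finally show ?case by simp
qed

text \<open>The bound is the same for every round, as \<open>polytime_fold\<close> requires of the
  accumulators. Without the bound on single solutions, entries made of copies of earlier entries
  might grow exponentially with the rounds.\<close>

lemma tsize_table:
  assumes K: "\<And>Y. Y \<in> set ss \<Longrightarrow> tsize (EV Y) \<le> K"
  shows "tsize (ET ((next_table vs es ss ^^ k) [])) \<le>
    tsize (enc_list (EV \<otimes> EV) (blocks vs es ss)) * (length vs * (K + 3) + 4)"
proof (cases k)
  case 0
  have "0 < tsize (enc_list (EV \<otimes> EV) (blocks vs es ss)) * (length vs * (K + 3) + 4)"
    using tsize_pos by simp
  then show ?thesis using 0 by simp
next
  case (Suc j)
  let ?tab = "(next_table vs es ss ^^ j) []" and ?M = "length vs * (K + 3)"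
  let ?bs = "blocks vs es ss"
  let ?ER = "enc_option (enc_rtree EV)"
  have entry: "tsize (?ER (attempt vs es ss ?tab b)) \<le> ?M + 2" if b: "b \<in> set ?bs" for b
  proof (cases "attempt vs es ss ?tab b")
    case (Some t)
    obtain X C where XC: "b = (X, C)" by (cases b)
    have "lookup ((next_table vs es ss ^^ Suc j) []) (X, C) = Some t"
      using Some b XC by (simp add: lookup_next_table)
    then have "Suc (tsize (enc_rtree EV t)) \<le> card (set C) * (K + 3)"
      by (rule tsize_lookup[rotated]) (rule K)
    also have "card (set C) \<le> length vs"
    proof -
      have "C \<in> set (comps vs es X)" using b XC by (simp add: mem_blocks)
      then have "set C \<subseteq> set vs" using component_subset[OF component_comps] by fastforce
      then have "card (set C) \<le> card (set vs)" by (simp add: card_mono)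
      also have "\<dots> \<le> length vs" by (rule card_length)
      finally show ?thesis .
    qed
    finally show ?thesis using Some by simp
  qed simp
  have "tsize (ET ((next_table vs es ss ^^ k) [])) =
      Suc (\<Sum>b\<leftarrow>?bs. Suc (Suc (tsize ((EV \<otimes> EV) b) + tsize (?ER (attempt vs es ss ?tab b)))))"
    by (simp add: Suc next_table_def tsize_enc_list comp_def)
  \<comment> \<open>In \<open>?M + 4\<close>, the value of an entry takes \<open>?M + 2\<close>, and
    one each is for the node pairing it with the key and for the list cell.\<close>
  also have "\<dots> \<le> Suc (\<Sum>b\<leftarrow>?bs. Suc (tsize ((EV \<otimes> EV) b)) * (?M + 4))"
  proof (intro Suc_le_mono[THEN iffD2] sum_list_mono)
    fix b assume "b \<in> set ?bs"
    have "Suc (Suc (tsize ((EV \<otimes> EV) b) + tsize (?ER (attempt vs es ss ?tab b)))) \<le>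
        tsize ((EV \<otimes> EV) b) + (?M + 4)"
      using entry[OF \<open>b \<in> set ?bs\<close>] by simp
    also have "\<dots> \<le> Suc (tsize ((EV \<otimes> EV) b)) * (?M + 4)" by simp
    finally show "Suc (Suc (tsize ((EV \<otimes> EV) b) + tsize (?ER (attempt vs es ss ?tab b)))) \<le> \<dots>" .
  qed
  also have "\<dots> \<le> Suc (\<Sum>b\<leftarrow>?bs. Suc (tsize ((EV \<otimes> EV) b))) * (?M + 4)"
  proof -
    have "Suc (n * (m + 4)) \<le> Suc n * (m + 4)" for n m :: nat by simp
    then show ?thesis unfolding sum_list_mult_const .
  qed
  finally show ?thesis by (simp only: tsize_enc_list)
qed

text \<open>The size bound holds for tables reached from \<open>[]\<close>, not for arbitrary
  accumulators, so the general \<open>polytime_fold\<close> is needed here. The size of the encoding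
  of all of \<open>ss\<close> serves as the bound \<open>K\<close> on single bags.\<close>

lemma polytime_table:
  assumes vs: "polytime E EV vs" and es: "polytime E EF es" and ss: "polytime E EF ss"
  shows "polytime E ET (\<lambda>x. table (vs x) (es x) (ss x))"
proof -
  note vars = polytime_compose[OF _ vs] polytime_compose[OF _ es] polytime_compose[OF _ ss]
  show ?thesis unfolding table_def
  proof (rule polytime_fold[OF vs polytime_const])
    show "polytime (E \<otimes> enc_nat \<otimes> ET) ET
        (\<lambda>p. next_table (vs (fst p)) (es (fst p)) (ss (fst p)) (snd (snd p)))"
      by (rule vars polytime_next_table polytime_rules)+
    show "pbound (\<lambda>x. tsize (E x)) (\<lambda>x. tsize (enc_list (EV \<otimes> EV) (blocks (vs x) (es x) (ss x))) *
        (tsize (EV (vs x)) * (tsize (EF (ss x)) + 3) + 4))"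
      by (intro pbound_intros polytime_size[OF vs] polytime_size[OF ss]
          polytime_size[OF polytime_blocks[OF vs es ss]])
    fix x j
    have "tsize (EV Y) \<le> tsize (EF (ss x))" if "Y \<in> set (ss x)" for Y
      by (rule tsize_elem_le[OF that])
    then have "tsize (ET (fold (\<lambda>_. next_table (vs x) (es x) (ss x)) (take j (vs x)) [])) \<le>
        tsize (enc_list (EV \<otimes> EV) (blocks (vs x) (es x) (ss x))) *
          (length (vs x) * (tsize (EF (ss x)) + 3) + 4)"
      unfolding fold_const by (rule tsize_table)
    also have "\<dots> \<le> tsize (enc_list (EV \<otimes> EV) (blocks (vs x) (es x) (ss x))) *
          (tsize (EV (vs x)) * (tsize (EF (ss x)) + 3) + 4)"
      by (intro mult_le_mono add_le_mono length_le_tsize order_refl)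
    finally show "tsize (ET (fold (\<lambda>_. next_table (vs x) (es x) (ss x)) (take j (vs x)) [])) \<le> \<dots>" .
  qed
qed

section \<open>The polynomial-time program\<close>

lemma polytime_solve:
  assumes vs: "polytime E EV vs" and es: "polytime E EF es" and ss: "polytime E EF ss"
  shows "polytime E (enc_option (enc_rtree EV)) (\<lambda>x. solve (vs x) (es x) (ss x))"
proof -
  have tab: "polytime E ET (\<lambda>x. table (vs x) (es x) (ss x))"
    by (rule polytime_table[OF vs es ss])
  note vars = polytime_compose[OF _ vs] polytime_compose[OF _ es] polytime_compose[OF _ ss]
    polytime_compose[OF _ tab]
  show ?thesis unfolding solve_def
    by (rule vars polytime_first_some polytime_extend polytime_rules)+
qed

lemma polytime_program:
  assumes "polytime E F f"
  shows "\<exists>c q. \<forall>x. \<exists>t. computes_in c (E x) t (F (f x)) \<and> t \<le> poly q (tsize (E x))"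
proof -
  obtain c N T where c: "implements c N T E F f" and "pbound (\<lambda>x. tsize (E x)) T"
    using assms by (rule polytime_obtain)
  then obtain q where q: "T x \<le> poly q (tsize (E x))" for x unfolding pbound_def by blast
  have "\<exists>t. computes_in c (E x) t (F (f x)) \<and> t \<le> poly q (tsize (E x))" for x
  proof -
    have "((\<lambda>_. Leaf)(0 := E x) :: store) 0 = E x" by simp
    from c this obtain s' where s': "runs c ((\<lambda>_. Leaf)(0 := E x)) (T x) s'" "s' 0 = F (f x)"
      by (rule implementsE) blast
    then obtain t where t: "t \<le> T x" "exec c ((\<lambda>_. Leaf)(0 := E x)) t s'" by (auto simp: runs_def)
    then have "computes_in c (E x) t (F (f x))" using s'(2) unfolding computes_in_def by metis
    then show ?thesis using t(1) q[of x] by (meson order_trans)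
  qed
  then show ?thesis by blast
qed

theorem theorem4p5:
  "\<exists>(c :: com) (q :: nat poly).
     \<forall>(vs :: nat list) (es :: nat list list) (ss :: nat list list) H S.
       H = \<lparr> verts = set vs, edges = set (map set es) \<rparr> \<and>
       S = set (map set ss) \<and>
       hypergraph H \<and> S \<subseteq> Pow (verts H)
       \<longrightarrow>
       (\<exists>t out.
          computes_in c (enc_input vs es ss) t out \<and>
          t \<le> poly q (tsize (enc_input vs es ss)) \<and>
          (if \<exists>T. candidate_td H S T \<and> component_normal_form H T
           then \<exists>D. out = enc_output (Some D) \<and>
                    candidate_td H S (map_rtree set D) \<and>
                    component_normal_form H (map_rtree set D)
           else out = enc_output None))"
proof -
  \<comment> \<open>\<open>enc_input\<close> and \<open>enc_output\<close> are these product and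
    option encodings written out, so \<open>solve\<close>, read as a function on triples, is what
    the program has to compute.\<close>
  have "polytime (EV \<otimes> EF \<otimes> EF) (enc_option (enc_rtree EV))
      (\<lambda>x. solve (fst x) (fst (snd x)) (snd (snd x)))"
    by (rule polytime_solve polytime_basic)+
  then obtain c q where "\<forall>x. \<exists>t. computes_in c ((EV \<otimes> EF \<otimes> EF) x) t
      (enc_option (enc_rtree EV) (solve (fst x) (fst (snd x)) (snd (snd x)))) \<and>
      t \<le> poly q (tsize ((EV \<otimes> EF \<otimes> EF) x))"
    using polytime_program by blast
  note run = this[rule_format, of "(vs, es, ss)" for vs es ss]
  show ?thesis
  proof (intro exI[of _ c] exI[of _ q] allI impI, elim conjE)
    fix vs es ss H and S :: "nat set set"
    assume "H = \<lparr> verts = set vs, edges = set (map set es) \<rparr>" "S = set (map set ss)"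
      and HS: "hypergraph H" "S \<subseteq> Pow (verts H)"
    then have H: "H = hg vs es" and S: "S = set ` set ss" by (simp_all add: hg_def)
    have sub: "set ` set ss \<subseteq> Pow (set vs)" using HS(2) H S by simp
    obtain t where t: "computes_in c (enc_input vs es ss) t (enc_output (solve vs es ss))"
      "t \<le> poly q (tsize (enc_input vs es ss))"
      using run[of vs es ss] by (auto simp: enc_input_def enc_output_def)
    show "\<exists>t out. computes_in c (enc_input vs es ss) t out \<and>
          t \<le> poly q (tsize (enc_input vs es ss)) \<and>
          (if \<exists>T. candidate_td H S T \<and> component_normal_form H T
           then \<exists>D. out = enc_output (Some D) \<and>
                    candidate_td H S (map_rtree set D) \<and>
                    component_normal_form H (map_rtree set D)
           else out = enc_output None)"
    proof (intro exI conjI)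
      show "if \<exists>T. candidate_td H S T \<and> component_normal_form H T
           then \<exists>D. enc_output (solve vs es ss) = enc_output (Some D) \<and>
                    candidate_td H S (map_rtree set D) \<and>
                    component_normal_form H (map_rtree set D)
           else enc_output (solve vs es ss) = enc_output None"
      proof (cases "solve vs es ss")
        case None
        then show ?thesis using solve_correct(2)[OF HS(1)[unfolded H] sub None] H S by auto
      next
        case (Some D)
        then show ?thesis using solve_correct(1)[OF HS(1)[unfolded H] sub Some] H S by auto
      qed
    qed (fact t)+
  qed
qed

end
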